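(* Let $\alpha\in\mathbb R$, let $m\in\mathbb N_0$, and let $(s_j)_{j=0}^m\in\mathcal K^{\ge}_{q,m,\alpha}$. Let $(Q_j)_{j=0}^m$ be the right $\alpha$-Stieltjes parametrization of $(s_j)_{j=0}^m$, and for $0\le k\le m$ let $(s_j^{[k,\alpha]})_{j=0}^{m-k}$ be the $k$-th $\alpha$-Schur transform of $(s_j)_{j=0}^m$. Then $$Q_m=s_0^{[m,\alpha]}+R_{m,m},$$ and, in the case $m\ge1$, furthermore $Q_j=s_0^{[j,\alpha]}$ for all integers $j$ with $0\le j\le m-1$.
   Context: Let $q\in\mathbb N=\{1,2,\dots\}$; $\mathbb N_0=\{0,1,2,\dots\}$. All sequences consist of complex $q\times q$ matrices. $A\ge0$ means that $A$ is nonnegative Hermitian (Hermitian positive semidefinite), and $A^\dagger$ is the Moore–Penrose inverse of $A$. Block Hankel matrices. For a sequence $(s_j)$ put $H_n=[s_{j+k}]_{j,k=0}^n$, $s_{\alpha,j}=-\alpha s_j+s_{j+1}$, and $H_{\alpha,n}=[s_{\alpha,j+k}]_{j,k=0}^n$ (whenever the entries are available). Classes. $\mathcal K^{\ge}_{q,0,\alpha}$ is the set of all $(s_j)_{j=0}^0$ with $s_0\ge0$. For $n\ge1$, $\mathcal K^{\ge}_{q,2n,\alpha}$ is the set of all $(s_j)_{j=0}^{2n}$ with $H_n\ge0$ and $H_{\alpha,n-1}\ge0$. For $n\ge0$, $\mathcal K^{\ge}_{q,2n+1,\alpha}$ is the set of all $(s_j)_{j=0}^{2n+1}$ with $H_n\ge0$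 and $H_{\alpha,n}\ge0$. Right $\alpha$-Stieltjes parametrization. Put $L_0=s_0$ and, for $n\ge1$, $L_n=s_{2n}-[s_n,\dots,s_{2n-1}]\,H_{n-1}^\dagger\,\begin{bmatrix}s_n\\ \vdots\\ s_{2n-1}\end{bmatrix}$; let $L_{\alpha,n}$ be the matrix built in the same way from the sequence $(s_{\alpha,j})$ in place of $(s_j)$ (so $L_{\alpha,0}=s_{\alpha,0}$). The right $\alpha$-Stieltjes parametrization $(Q_j)$ of $(s_j)$ is given by $Q_{2k}=L_k$ and $Q_{2k+1}=L_{\alpha,k}$. $\alpha$-Schur transforms. The $[+,\alpha]$-transform of $(s_j)$ is $(u_j)$ with $u_j=-\alpha s_{j-1}+s_j$, where $s_{-1}=0$. The reciprocal sequence of a sequence $(u_j)$ is given by $u_0^\sharp=u_0^\dagger$ and $u_j^\sharp=-u_0^\dagger\sum_{l=0}^{j-1}u_{j-l}u_l^\sharp$ for $j\ge1$. Put $s_j^{\sharp,\alpha}=u_j^\sharp$ where $(u_j)$ is the $[+,\alpha]$-transform of $(s_j)$. The first $\alpha$-Schur transform of a sequence $(s_j)_{j=0}^{\kappa}$ with $\kappa\ge1$ is $(s_j^{[1,\alpha]})_{j=0}^{\kappa-1}$ with $s_j^{[1,\alpha]}=-s_0\,s_{j+1}^{\sharp,\alpha}\,s_0$. The $0$-th $\alpha$-Schur transform of $(s_j)$ is $(s_j)$ itself, and for $k\ge1$ the $k$-th $\alpha$-Schur transform $(s_j^{[k,\alpha]})_{j=0}^{\kappa-k}$ is the first $\alpha$-Schur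 transform of the $(k-1)$-th one. Defect matrices. $E_{j,k}=s_j^{[k,\alpha]}-s_0^{[k,\alpha]}(s_0^{[k,\alpha]})^\dagger s_j^{[k,\alpha]}(s_0^{[k,\alpha]})^\dagger s_0^{[k,\alpha]}$; and for $l\ge m$: $R_{l,0}=0$ and $R_{l,m}=\sum_{k=0}^{m-1}E_{l-k,k}$ if $m\ge1$. *)

theory Defs
  imports "Jordan_Normal_Form.Schur_Decomposition"
begin

text \<open>
  A finite sequence \<open>(s\<^sub>0, \<dots>, s\<^sub>m)\<close> of complex \<open>q \<times> q\<close> matrices is represented by a function
  \<open>s :: nat \<Rightarrow> complex mat\<close> of which only the values at \<open>0, \<dots>, m\<close> are constrained.  Every
  construction below evaluates \<open>s\<close> only at the indices occurring in the corresponding formula, so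
  values beyond \<open>m\<close> play no role in the objects attached to \<open>(s\<^sub>0, \<dots>, s\<^sub>m)\<close>.
\<close>

definition nonneg_hermitian :: "complex mat \<Rightarrow> bool" where
  "nonneg_hermitian A \<longleftrightarrow>
     square_mat A \<and> mat_adjoint A = A \<and>
     (\<forall>v \<in> carrier_vec (dim_row A). 0 \<le> Re ((A *\<^sub>v v) \<bullet>c v))"

definition is_moore_penrose :: "complex mat \<Rightarrow> complex mat \<Rightarrow> bool" where
  "is_moore_penrose A X \<longleftrightarrow>
     X \<in> carrier_mat (dim_col A) (dim_row A) \<and>
     A * X * A = A \<and> X * A * X = X \<and>
     mat_adjoint (A * X) = A * X \<and> mat_adjoint (X * A) = X * A"

text \<open>Every complex matrix has exactly one Moore--Penrose inverse.\<close>

definition pinv :: "complex mat \<Rightarrow> complex mat" where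
  "pinv A = (THE X. is_moore_penrose A X)"

text \<open>Matrices of unspecified size form no additive monoid, so a sum of \<open>q \<times> q\<close> matrices
  is taken entrywise; the empty sum is the \<open>q \<times> q\<close> zero matrix.\<close>

definition msum :: "nat \<Rightarrow> (nat \<Rightarrow> complex mat) \<Rightarrow> nat set \<Rightarrow> complex mat" where
  "msum q f I = mat q q (\<lambda>(i, j). \<Sum>l\<in>I. f l $$ (i, j))"

lemma msum_cong [fundef_cong]:
  assumes "q = q'" "I = J" "\<And>l. l \<in> J \<Longrightarrow> f l = g l"
  shows "msum q f I = msum q' g J"
proof -
  have "(\<Sum>l\<in>I. f l $$ (i, j)) = (\<Sum>l\<in>J. g l $$ (i, j))" for i j
    using assms by (intro sum.cong) auto
  then show ?thesis using assms(1) by (simp add: msum_def)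
qed

text \<open>Row (or column) index \<open>a\<close> of a block matrix belongs to block \<open>a div q\<close>, position
  \<open>a mod q\<close>.\<close>

definition block_hankel :: "nat \<Rightarrow> (nat \<Rightarrow> complex mat) \<Rightarrow> nat \<Rightarrow> complex mat" where
  "block_hankel q s n =
     mat ((n + 1) * q) ((n + 1) * q) (\<lambda>(a, b). s (a div q + b div q) $$ (a mod q, b mod q))"

text \<open>The block row \<open>[s\<^sub>n, \<dots>, s\<^sub>2\<^sub>n\<^sub>-\<^sub>1]\<close> and the block column with the same entries.\<close>

definition block_row :: "nat \<Rightarrow> (nat \<Rightarrow> complex mat) \<Rightarrow> nat \<Rightarrow> complex mat" where
  "block_row q s n = mat q (n * q) (\<lambda>(a, b). s (n + b div q) $$ (a, b mod q))"

definition block_col :: "nat \<Rightarrow> (nat \<Rightarrow> complex mat) \<Rightarrow> nat \<Rightarrow> complex mat" where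
  "block_col q s n = mat (n * q) q (\<lambda>(a, b). s (n + a div q) $$ (a mod q, b))"

definition shift_seq :: "real \<Rightarrow> (nat \<Rightarrow> complex mat) \<Rightarrow> nat \<Rightarrow> complex mat" where
  "shift_seq \<alpha> s j = (- complex_of_real \<alpha>) \<cdot>\<^sub>m s j + s (j + 1)"

definition stieltjes_class :: "nat \<Rightarrow> nat \<Rightarrow> real \<Rightarrow> (nat \<Rightarrow> complex mat) set" where
  "stieltjes_class q m \<alpha> =
     {s. (\<forall>j\<le>m. s j \<in> carrier_mat q q) \<and>
         (if m = 0 then nonneg_hermitian (s 0)
          else if even m then
            nonneg_hermitian (block_hankel q s (m div 2)) \<and>
            nonneg_hermitian (block_hankel q (shift_seq \<alpha> s) (m div 2 - 1))
          else
            nonneg_hermitian (block_hankel q s (m div 2)) \<and>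
            nonneg_hermitian (block_hankel q (shift_seq \<alpha> s) (m div 2)))}"

definition schur_compl :: "nat \<Rightarrow> (nat \<Rightarrow> complex mat) \<Rightarrow> nat \<Rightarrow> complex mat" where
  "schur_compl q s n =
     (if n = 0 then s 0
      else s (2 * n) - block_row q s n * pinv (block_hankel q s (n - 1)) * block_col q s n)"

definition stieltjes_param :: "nat \<Rightarrow> real \<Rightarrow> (nat \<Rightarrow> complex mat) \<Rightarrow> nat \<Rightarrow> complex mat" where
  "stieltjes_param q \<alpha> s j =
     (if even j then schur_compl q s (j div 2)
      else schur_compl q (shift_seq \<alpha> s) (j div 2))"

text \<open>The \<open>[+,\<alpha>]\<close>-transform, with the convention \<open>s\<^sub>-\<^sub>1 = 0\<close>.\<close>

definition plus_transform :: "real \<Rightarrow> (nat \<Rightarrow> complex mat) \<Rightarrow> nat \<Rightarrow> complex mat" where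
  "plus_transform \<alpha> s j =
     (if j = 0 then s 0 else (- complex_of_real \<alpha>) \<cdot>\<^sub>m s (j - 1) + s j)"

fun reciprocal_seq :: "nat \<Rightarrow> (nat \<Rightarrow> complex mat) \<Rightarrow> nat \<Rightarrow> complex mat" where
  "reciprocal_seq q u 0 = pinv (u 0)"
| "reciprocal_seq q u (Suc j) =
     - (pinv (u 0) * msum q (\<lambda>l. u (Suc j - l) * reciprocal_seq q u l) {0..j})"

definition schur_transform1 :: "nat \<Rightarrow> real \<Rightarrow> (nat \<Rightarrow> complex mat) \<Rightarrow> nat \<Rightarrow> complex mat" where
  "schur_transform1 q \<alpha> s j =
     - (s 0 * reciprocal_seq q (plus_transform \<alpha> s) (j + 1) * s 0)"

fun schur_transform ::
  "nat \<Rightarrow> real \<Rightarrow> nat \<Rightarrow> (nat \<Rightarrow> complex mat) \<Rightarrow> nat \<Rightarrow> complex mat" where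
  "schur_transform q \<alpha> 0 s = s"
| "schur_transform q \<alpha> (Suc k) s = schur_transform1 q \<alpha> (schur_transform q \<alpha> k s)"

definition defect ::
  "nat \<Rightarrow> real \<Rightarrow> (nat \<Rightarrow> complex mat) \<Rightarrow> nat \<Rightarrow> nat \<Rightarrow> complex mat" where
  "defect q \<alpha> s j k =
     (let t = schur_transform q \<alpha> k s
      in t j - t 0 * pinv (t 0) * t j * pinv (t 0) * t 0)"

definition defect_sum ::
  "nat \<Rightarrow> real \<Rightarrow> (nat \<Rightarrow> complex mat) \<Rightarrow> nat \<Rightarrow> nat \<Rightarrow> complex mat" where
  "defect_sum q \<alpha> s l m = msum q (\<lambda>k. defect q \<alpha> s (l - k) k) {0..<m}"

end

theory Submission
  imports Defs "HOL-Computational_Algebra.Formal_Power_Series"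
begin

text \<open>
  The theorem is the iteration of a statement about one Schur transform: if \<open>t\<close> is the first
  \<open>\<alpha>\<close>-Schur transform of \<open>s\<close>, and \<open>s\<close> is in the class for \<open>m \<ge> 1\<close>, then \<open>t\<close> is in the class
  with \<open>m - 1\<close> instead of \<open>m\<close>, its parameters are those of \<open>s\<close> shifted by one,
  \<open>Q\<^sub>j\<^sub>+\<^sub>1(s) = Q\<^sub>j(t)\<close> for \<open>j + 1 < m\<close>, and \<open>Q\<^sub>m(s) = Q\<^sub>m\<^sub>-\<^sub>1(t) + E\<^sub>m\<^sub>,\<^sub>0\<close>
  (\<open>stieltjes_param_schur_transform1\<close>). The defects \<open>E\<^sub>j\<^sub>,\<^sub>k\<close> of \<open>t\<close> are the \<open>E\<^sub>j\<^sub>,\<^sub>k\<^sub>+\<^sub>1\<close>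
  of \<open>s\<close>, so induction on \<open>m\<close> collects the sum \<open>R\<^sub>m\<^sub>,\<^sub>m\<close>.

  Suppose first that all \<open>s\<^sub>j\<close> act on the range of \<open>s\<^sub>0\<close> only, that is, \<open>s\<^sub>j = P s\<^sub>j P\<close> with
  the orthogonal projector \<open>P = s\<^sub>0 s\<^sub>0\<^sup>\<dagger>\<close>. Put \<open>S(z) = \<Sum> s\<^sub>j z\<^sup>j\<close>, \<open>U(z) = (1 - \<alpha> z) S(z)\<close>
  and \<open>T(z) = \<Sum> t\<^sub>j z\<^sup>j\<close>, and take inverses relative to \<open>P\<close>. By definition
  \<open>z T = s\<^sub>0 - s\<^sub>0 U\<^sup>-\<^sup>1 s\<^sub>0\<close>. The Hankel matrix of a sequence with series \<open>F\<close> has the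
  generating function \<open>(z F(z) - w F(w)) / (z - w)\<close>, and inserting \<open>T\<close> shows that the Hankel
  matrix of \<open>t\<close> is \<open>X H X\<^sup>*\<close>, where \<open>H\<close> is the Hankel matrix of the shifted sequence \<open>s\<^sub>\<alpha>\<close>
  and \<open>X\<close> is the block lower triangular Toeplitz matrix of \<open>s\<^sub>0 U\<^sup>-\<^sup>1\<close>. Likewise the direct
  sum of \<open>s\<^sub>0\<close> and the Hankel matrix of \<open>t\<^sub>\<alpha>\<close> is congruent to the Hankel matrix of \<open>s\<close> by
  the Toeplitz matrix of \<open>s\<^sub>0 S\<^sup>-\<^sup>1\<close> (\<open>hankel_T\<close> and \<open>hankel_B\<close>, from \<open>hankel_cong_inverse\<close>
  and \<open>shifted_hankel_cong_inverse\<close>). Such congruences preserve nonnegativity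
  (\<open>block_psd_toeplitz_cong\<close>), and as their diagonal blocks are \<open>P\<close>, they also preserve the
  Schur complements that define the parameters (\<open>right_schur_compl_toeplitz_cong\<close>).

  In general, nonnegativity gives \<open>s\<^sub>j = P s\<^sub>j P\<close> for \<open>j < m\<close> but not for \<open>j = m\<close>
  (\<open>stieltjes_kernel\<close>). Replacing \<open>s\<^sub>m\<close> by \<open>P s\<^sub>m P\<close> leaves the Schur transform unchanged
  and subtracts from the last parameter the difference of the two matrices, which is
  \<open>E\<^sub>m\<^sub>,\<^sub>0\<close>.

  The calculations take place in a noncommutative ring of operators that contains the
  \<open>q \<times> q\<close> matrices, with Schur complements described by solvability of a linear system. All
  that is needed of the Moore--Penrose inverse is \<open>pinv_hermitian\<close>.
\<close>

section \<open>Reciprocal sequences and Hankel arrays over a ring\<close>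

text \<open>
  As power series, \<open>r\<close> inverts \<open>u\<close> on both sides with \<open>p\<close> in the place of the unit. In the
  application \<open>p\<close> is the projector onto the range of a singular matrix, on which alone
  inversion makes sense.
\<close>

definition conv_inverse :: "'a::ring_1 \<Rightarrow> (nat \<Rightarrow> 'a) \<Rightarrow> (nat \<Rightarrow> 'a) \<Rightarrow> bool" where
  "conv_inverse p u r \<longleftrightarrow>
     (\<forall>j. (\<Sum>l\<le>j. u (j - l) * r l) = (if j = 0 then p else 0)) \<and>
     (\<forall>j. (\<Sum>l\<le>j. r (j - l) * u l) = (if j = 0 then p else 0)) \<and>
     (\<forall>j. p * r j = r j \<and> r j * p = r j)"

fun recip :: "'a::ring_1 \<Rightarrow> (nat \<Rightarrow> 'a) \<Rightarrow> nat \<Rightarrow> 'a" where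
  "recip g u 0 = g"
| "recip g u (Suc j) = - (g * (\<Sum>l\<le>j. u (Suc j - l) * recip g u l))"

fun left_recip :: "'a::ring_1 \<Rightarrow> (nat \<Rightarrow> 'a) \<Rightarrow> nat \<Rightarrow> 'a" where
  "left_recip g u 0 = g"
| "left_recip g u (Suc j) = - ((\<Sum>l\<le>j. left_recip g u l * u (Suc j - l)) * g)"

lemma sum_atMost_flip: "(\<Sum>l\<le>j. f l (j - l)) = (\<Sum>l\<le>(j::nat). f (j - l) l)"
  by (rule sum.reindex_bij_witness[of _ "\<lambda>l. j - l" "\<lambda>l. j - l"]) auto

lemma conv_eq_fps:
  assumes "\<And>j. (\<Sum>l\<le>j. x l * y (j - l)) = (if j = 0 then p else (0::'a::ring_1))"
  shows "Abs_fps x * Abs_fps y = fps_const p"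
  by (rule fps_ext) (simp add: fps_mult_nth assms atLeast0AtMost)

text \<open>
  The recursion of \<open>recip\<close> produces a right inverse of \<open>u\<close>, and its mirror image
  \<open>left_recip\<close> a left inverse. Associativity of the product of power series forces the two
  to coincide, so the reciprocal is two-sided and obeys both recursions; the second one is
  what makes it inherit self-adjointness from \<open>u\<close>.
\<close>

lemma
  fixes g p :: "'a::ring_1"
  assumes ug: "u 0 * g = p" "g * u 0 = p" and gp: "g * p = g" "p * g = g"
    and up: "\<And>j. u j * p = u j" "\<And>j. p * u j = u j"
  shows conv_inverse_recip: "conv_inverse p u (recip g u)"
    and recip_Suc_left: "recip g u (Suc j) = - ((\<Sum>l\<le>j. recip g u l * u (Suc j - l)) * g)"
proof -
  let ?r = "recip g u" and ?q = "left_recip g u"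
  have pr: "p * ?r j = ?r j" for j
    by (cases j) (auto simp: gp mult.assoc[symmetric])
  have qp: "?q j * p = ?q j" for j
    by (cases j) (auto simp: gp mult.assoc)
  have R: "(\<Sum>l\<le>j. u (j - l) * ?r l) = (if j = 0 then p else 0)" for j
  proof (cases j)
    case (Suc i)
    have "p * (\<Sum>l\<le>i. u (Suc i - l) * ?r l) = (\<Sum>l\<le>i. u (Suc i - l) * ?r l)"
      by (simp add: sum_distrib_left mult.assoc[symmetric] up)
    then show ?thesis
      by (simp add: Suc mult.assoc[symmetric] ug)
  qed (simp add: ug)
  have Q: "(\<Sum>l\<le>j. ?q l * u (j - l)) = (if j = 0 then p else 0)" for j
  proof (cases j)
    case (Suc i)
    have "(\<Sum>l\<le>i. ?q l * u (Suc i - l)) * p = (\<Sum>l\<le>i. ?q l * u (Suc i - l))"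
      by (simp add: sum_distrib_right mult.assoc up)
    then show ?thesis
      by (simp add: Suc mult.assoc ug)
  qed (simp add: ug)
  have 1: "Abs_fps u * Abs_fps ?r = fps_const p"
    by (rule conv_eq_fps) (subst sum_atMost_flip, rule R)
  have 2: "Abs_fps ?q * Abs_fps u = fps_const p"
    by (rule conv_eq_fps) (rule Q)
  have "Abs_fps ?q = Abs_fps ?q * fps_const p"
    by (rule fps_ext) (simp add: qp)
  also have "\<dots> = fps_const p * Abs_fps ?r"
    by (metis 1 2 mult.assoc)
  also have "\<dots> = Abs_fps ?r"
    by (rule fps_ext) (simp add: pr)
  finally have eq: "?q = ?r"
    by (auto simp: fps_eq_iff)
  show "conv_inverse p u ?r"
    unfolding conv_inverse_def
    using R pr Q[unfolded eq] qp[unfolded eq] sum_atMost_flip[of "\<lambda>i k. ?r i * u k"]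
    by simp
  show "recip g u (Suc j) = - ((\<Sum>l\<le>j. recip g u l * u (Suc j - l)) * g)"
    using left_recip.simps(2)[of g u j] unfolding eq .
qed

text \<open>
  The product \<open>X h Y\<close>, where \<open>X\<close> is the block lower triangular Toeplitz matrix of \<open>x\<close> and
  \<open>Y\<close> the block upper triangular one of \<open>y\<close>.
\<close>

definition toeplitz_cong ::
  "(nat \<Rightarrow> 'a::ring_1) \<Rightarrow> (nat \<Rightarrow> nat \<Rightarrow> 'a) \<Rightarrow> (nat \<Rightarrow> 'a) \<Rightarrow> nat \<Rightarrow> nat \<Rightarrow> 'a" where
  "toeplitz_cong x h y j k = (\<Sum>l\<le>j. \<Sum>i\<le>k. x (j - l) * h l i * y (k - i))"

definition hankel :: "(nat \<Rightarrow> 'a) \<Rightarrow> nat \<Rightarrow> nat \<Rightarrow> 'a" where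
  "hankel s j k = s (j + k)"

text \<open>
  The Hankel array of \<open>u\<close> has the generating function \<open>(z u(z) - w u(w)) / (z - w)\<close>.
  Multiplication by \<open>r(z) = 1 / u(z)\<close> on the left and by \<open>r(w)\<close> on the right gives
  \<open>(z r(w) - w r(z)) / (z - w)\<close>, which is \<open>r\<^sub>0\<close> minus the sum of the \<open>r\<^sub>j\<^sub>+\<^sub>k z\<^sup>j w\<^sup>k\<close> with
  \<open>j, k \<ge> 1\<close>. For the shifted sequence the kernel \<open>(u(z) - u(w)) / (z - w)\<close> turns into
  \<open>(r(w) - r(z)) / (z - w)\<close> in the same way. On coefficients: splitting off the first row,
  or the first column, of the double sum expresses the first congruence through the second
  one in two ways, and comparing them determines both by induction on the row.
\<close>

lemma
  fixes u r :: "nat \<Rightarrow> 'a::ring_1"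
  assumes inv: "conv_inverse p u r"
  shows hankel_cong_inverse:
      "toeplitz_cong r (hankel u) r j k =
        (if j = 0 \<and> k = 0 then r 0 else if j = 0 \<or> k = 0 then 0 else - r (j + k))"
    and shifted_hankel_cong_inverse:
      "toeplitz_cong r (hankel (\<lambda>i. u (Suc i))) r j k = - r (Suc (j + k))"
proof -
  let ?D = "toeplitz_cong r (hankel u) r"
  let ?G = "toeplitz_cong r (hankel (\<lambda>i. u (Suc i))) r"
  have ur: "(\<Sum>l\<le>j. u l * r (j - l)) = (if j = 0 then p else 0)" for j
    using inv sum_atMost_flip[of "\<lambda>i k. u i * r k"] unfolding conv_inverse_def by simp
  have ru: "(\<Sum>l\<le>j. r (j - l) * u l) = (if j = 0 then p else 0)" for j
    using inv unfolding conv_inverse_def by simp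
  have pr: "p * r j = r j" "r j * p = r j" for j
    using inv unfolding conv_inverse_def by auto
  have row: "?D (Suc j) k = ?G j k + (if k = 0 then r (Suc j) else 0)" for j k
  proof -
    have "?D (Suc j) k = (\<Sum>i\<le>k. r (Suc j) * u i * r (k - i)) + ?G j k"
      unfolding toeplitz_cong_def hankel_def by (subst sum.atMost_Suc_shift) simp
    also have "(\<Sum>i\<le>k. r (Suc j) * u i * r (k - i)) = r (Suc j) * (\<Sum>i\<le>k. u i * r (k - i))"
      by (simp add: sum_distrib_left mult.assoc)
    finally show ?thesis by (simp add: ur pr)
  qed
  have col: "?D j (Suc k) = ?G j k + (if j = 0 then r (Suc k) else 0)" for j k
  proof -
    have "?D j (Suc k) = (\<Sum>l\<le>j. r (j - l) * u l * r (Suc k)) + ?G j k"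
      unfolding toeplitz_cong_def hankel_def
      by (subst sum.atMost_Suc_shift) (simp add: sum.distrib)
    also have "(\<Sum>l\<le>j. r (j - l) * u l * r (Suc k)) = (\<Sum>l\<le>j. r (j - l) * u l) * r (Suc k)"
      by (simp add: sum_distrib_right)
    finally show ?thesis by (simp add: ru pr)
  qed
  have zero: "?D 0 k = (if k = 0 then r 0 else 0)" for k
  proof -
    have "?D 0 k = r 0 * (\<Sum>i\<le>k. u i * r (k - i))"
      unfolding toeplitz_cong_def hankel_def by (simp add: sum_distrib_left mult.assoc)
    then show ?thesis by (simp add: ur pr)
  qed
  have G: "?G j k = - r (Suc (j + k))" for j k
  proof (induction j arbitrary: k)
    case 0
    show ?case using col[of 0 k] zero[of "Suc k"] by (simp add: eq_neg_iff_add_eq_0)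
  next
    case (Suc j)
    show ?case using col[of "Suc j" k] row[of j "Suc k"] Suc[of "Suc k"] by simp
  qed
  show "?G j k = - r (Suc (j + k))" by (rule G)
  show "?D j k = (if j = 0 \<and> k = 0 then r 0 else if j = 0 \<or> k = 0 then 0 else - r (j + k))"
    using zero[of k] row[of "j - 1" k] G[of "j - 1" k] by (cases j) auto
qed

text \<open>
  For a Hermitian nonnegative array the Schur complement \<open>L\<close> of the last diagonal block is
  characterized by the solvability of \<open>h z = (0, \<dots>, 0, L)\<close> with last entry \<open>z\<^sub>n = 1\<close>,
  because eliminating \<open>z\<^sub>0, \<dots>, z\<^sub>n\<^sub>-\<^sub>1\<close> leaves exactly \<open>L\<close>. This description needs no
  generalized inverse and makes sense over any ring; rows and columns give a left and a
  right version.
\<close>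

definition right_schur_compl :: "(nat \<Rightarrow> nat \<Rightarrow> 'a::ring_1) \<Rightarrow> nat \<Rightarrow> 'a \<Rightarrow> bool" where
  "right_schur_compl h n L \<longleftrightarrow>
     (\<exists>z. z n = 1 \<and> (\<forall>j\<le>n. (\<Sum>k\<le>n. h j k * z k) = (if j = n then L else 0)))"

definition left_schur_compl :: "(nat \<Rightarrow> nat \<Rightarrow> 'a::ring_1) \<Rightarrow> nat \<Rightarrow> 'a \<Rightarrow> bool" where
  "left_schur_compl h n L \<longleftrightarrow>
     (\<exists>w. w n = 1 \<and> (\<forall>k\<le>n. (\<Sum>j\<le>n. w j * h j k) = (if k = n then L else 0)))"

text \<open>
  Evaluating \<open>w h z\<close> in both orders gives \<open>L z\<^sub>n = w\<^sub>n L'\<close>.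
\<close>

lemma left_right_schur_compl_eq:
  assumes "left_schur_compl h n L" "right_schur_compl h n L'"
  shows "L = L'"
proof -
  obtain w where w: "w n = 1" "\<And>k. k \<le> n \<Longrightarrow> (\<Sum>j\<le>n. w j * h j k) = (if k = n then L else 0)"
    using assms(1) unfolding left_schur_compl_def by blast
  obtain z where z: "z n = 1" "\<And>j. j \<le> n \<Longrightarrow> (\<Sum>k\<le>n. h j k * z k) = (if j = n then L' else 0)"
    using assms(2) unfolding right_schur_compl_def by blast
  have "L = (\<Sum>k\<le>n. (if k = n then L else 0) * z k)"
    by (simp add: z(1) if_distrib[of "\<lambda>x. x * _"] cong: if_cong)
  also have "\<dots> = (\<Sum>k\<le>n. \<Sum>j\<le>n. w j * h j k * z k)"
    by (intro sum.cong) (simp_all add: w(2)[symmetric] sum_distrib_right)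
  also have "\<dots> = (\<Sum>j\<le>n. w j * (\<Sum>k\<le>n. h j k * z k))"
    by (subst sum.swap) (simp add: sum_distrib_left mult.assoc)
  also have "\<dots> = (\<Sum>j\<le>n. w j * (if j = n then L' else 0))"
    by (intro sum.cong) (simp_all add: z(2))
  also have "\<dots> = L'"
    by (simp add: w(1) if_distrib[of "\<lambda>x. _ * x"] cong: if_cong)
  finally show ?thesis .
qed

lemma sum_le_triangle:
  fixes f :: "nat \<Rightarrow> nat \<Rightarrow> 'a::comm_monoid_add"
  shows "(\<Sum>k\<le>n. \<Sum>i\<le>k. f k i) = (\<Sum>i\<le>n. \<Sum>k\<in>{i..n}. f k i)"
  unfolding sum.Sigma[OF finite_atMost ballI[OF finite_atMost]]
    sum.Sigma[OF finite_atMost ballI[OF finite_atLeastAtMost]]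
  by (rule sum.reindex_bij_witness[of _ "\<lambda>(i, k). (k, i)" "\<lambda>(k, i). (i, k)"]) auto

text \<open>
  Triangular congruences with diagonal \<open>p\<close> do not change the Schur complement of an array in
  the corner of \<open>p\<close>: if \<open>h z = (0, \<dots>, 0, L)\<close> and \<open>Y'\<close> inverts \<open>Y\<close> up to \<open>p\<close>, then \<open>X h Y\<close>
  maps \<open>Y' z\<close> to \<open>X (0, \<dots>, 0, L)\<close>, which is \<open>(0, \<dots>, 0, p L)\<close> because \<open>X\<close> is lower
  triangular, and \<open>p L = L\<close>.
\<close>

lemma right_schur_compl_toeplitz_cong:
  fixes h :: "nat \<Rightarrow> nat \<Rightarrow> 'a::ring_1"
  assumes L: "right_schur_compl h n L"
    and hp: "\<And>j k. j \<le> n \<Longrightarrow> k \<le> n \<Longrightarrow> h j k * p = h j k \<and> p * h j k = h j k"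
    and x0: "x 0 = p" and yp: "\<And>j. y j * p = y j"
    and y': "\<And>j. (\<Sum>l\<le>j. y (j - l) * y' l) = (if j = 0 then p else 0)" and y'0: "y' 0 = p"
  shows "right_schur_compl (toeplitz_cong x h y) n L"
proof -
  obtain z where z: "z n = 1" "\<And>j. j \<le> n \<Longrightarrow> (\<Sum>k\<le>n. h j k * z k) = (if j = n then L else 0)"
    using L unfolding right_schur_compl_def by blast
  \<comment> \<open>The last entry of \<open>Y' z\<close> is \<open>p\<close> instead of \<open>1\<close>; the summand \<open>1 - p\<close> corrects
    this and is annihilated by \<open>Y\<close>.\<close>
  define z' where "z' k = (\<Sum>i\<in>{k..n}. y' (i - k) * z i) + (if k = n then 1 - p else 0)" for k
  have z'n: "z' n = 1" by (simp add: z'_def y'0 z(1))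
  have yz: "(\<Sum>k\<in>{i..n}. y (k - i) * z' k) = p * z i" if i: "i \<le> n" for i
  proof -
    have "(\<Sum>k\<in>{i..n}. y (k - i) * z' k) =
        (\<Sum>k\<in>{i..n}. y (k - i) * (\<Sum>r\<in>{k..n}. y' (r - k) * z r)) + y (n - i) * (1 - p)"
      using i by (simp add: z'_def distrib_left sum.distrib if_distrib[of "\<lambda>x. _ * x"] cong: if_cong)
    also have "y (n - i) * (1 - p) = 0" by (simp add: algebra_simps yp)
    also have "(\<Sum>k\<in>{i..n}. y (k - i) * (\<Sum>r\<in>{k..n}. y' (r - k) * z r)) =
        (\<Sum>r\<in>{i..n}. \<Sum>k\<in>{i..r}. y (k - i) * y' (r - k) * z r)"
      unfolding sum_distrib_left mult.assoc[symmetric]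
        sum.Sigma[OF finite_atLeastAtMost ballI[OF finite_atLeastAtMost]]
      by (rule sum.reindex_bij_witness[of _ "\<lambda>(i, k). (k, i)" "\<lambda>(k, i). (i, k)"]) auto
    also have "\<dots> = (\<Sum>r\<in>{i..n}. (\<Sum>k\<in>{i..r}. y (k - i) * y' (r - k)) * z r)"
      by (simp add: sum_distrib_right)
    also have "\<dots> = (\<Sum>r\<in>{i..n}. (if r = i then p * z i else 0))"
    proof (rule sum.cong[OF refl])
      fix r assume r: "r \<in> {i..n}"
      have "(\<Sum>k\<in>{i..r}. y (k - i) * y' (r - k)) = (\<Sum>l\<le>r - i. y ((r - i) - l) * y' l)"
        by (rule sum.reindex_bij_witness[of _ "\<lambda>l. r - l" "\<lambda>k. r - k"]) (use r in auto)
      also have "\<dots> = (if r = i then p else 0)" using r y'[of "r - i"] by auto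
      finally show "(\<Sum>k\<in>{i..r}. y (k - i) * y' (r - k)) * z r = (if r = i then p * z i else 0)"
        by simp
    qed
    also have "\<dots> = p * z i" using i by simp
    finally show ?thesis by simp
  qed
  have "(\<Sum>k\<le>n. toeplitz_cong x h y j k * z' k) = (if j = n then L else 0)" if j: "j \<le> n" for j
  proof -
    have "(\<Sum>k\<le>n. toeplitz_cong x h y j k * z' k) =
        (\<Sum>k\<le>n. \<Sum>l\<le>j. \<Sum>i\<le>k. x (j - l) * h l i * (y (k - i) * z' k))"
      by (simp add: toeplitz_cong_def sum_distrib_right mult.assoc)
    also have "\<dots> = (\<Sum>l\<le>j. \<Sum>k\<le>n. \<Sum>i\<le>k. x (j - l) * h l i * (y (k - i) * z' k))"
      by (rule sum.swap)
    also have "\<dots> = (\<Sum>l\<le>j. x (j - l) * (\<Sum>i\<le>n. h l i * (\<Sum>k\<in>{i..n}. y (k - i) * z' k)))"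
      by (simp add: sum_le_triangle sum_distrib_left mult.assoc)
    also have "\<dots> = (\<Sum>l\<le>j. x (j - l) * (\<Sum>i\<le>n. h l i * z i))"
    proof -
      have "h l i * (\<Sum>k\<in>{i..n}. y (k - i) * z' k) = h l i * z i" if "l \<le> j" "i \<le> n" for l i
      proof -
        have "h l i * (p * z i) = h l i * z i"
          using that j hp[of l i] by (simp add: mult.assoc[symmetric])
        then show ?thesis using yz[of i] that by simp
      qed
      then show ?thesis by simp
    qed
    also have "\<dots> = (\<Sum>l\<le>j. if l = n then p * L else 0)"
      by (intro sum.cong refl) (use j in \<open>auto simp: z(2) x0\<close>)
    also have "\<dots> = (if j = n then p * L else 0)" using j by simp
    also have "p * L = L"
      using z(2)[of n] hp by (auto simp: sum_distrib_left mult.assoc[symmetric] intro!: sum.cong)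
    finally show ?thesis .
  qed
  then show ?thesis unfolding right_schur_compl_def using z'n by blast
qed

lemma right_schur_compl_drop_first:
  assumes L: "right_schur_compl h (Suc n) L"
    and "\<And>j. j \<le> n \<Longrightarrow> h (Suc j) 0 = 0"
    and "\<And>j k. j \<le> n \<Longrightarrow> k \<le> n \<Longrightarrow> h (Suc j) (Suc k) = h' j k"
  shows "right_schur_compl h' n L"
proof -
  obtain z where z: "z (Suc n) = 1"
      "\<And>j. j \<le> Suc n \<Longrightarrow> (\<Sum>k\<le>Suc n. h j k * z k) = (if j = Suc n then L else 0)"
    using L unfolding right_schur_compl_def by blast
  have "(\<Sum>k\<le>n. h' j k * z (Suc k)) = (if j = n then L else 0)" if "j \<le> n" for j
  proof -
    have "(\<Sum>k\<le>Suc n. h (Suc j) k * z k) = (\<Sum>k\<le>n. h' j k * z (Suc k))"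
      unfolding sum.atMost_Suc_shift using that assms(2,3) by simp
    then show ?thesis using z(2)[of "Suc j"] that by simp
  qed
  then show ?thesis unfolding right_schur_compl_def
    by (intro exI[of _ "\<lambda>k. z (Suc k)"]) (simp add: z(1))
qed

section \<open>Linear operators on sequences, adjoints and nonnegative block forms\<close>

text \<open>
  Complex \<open>q \<times> q\<close> matrices, with \<open>q\<close> a variable, do not form a type, whereas the arguments
  above live in a ring. The linear operators on complex sequences form one, and a \<open>q \<times> q\<close>
  matrix embeds into it by acting on the first \<open>q\<close> coordinates.
\<close>

typedef seq_op = "{f :: (nat \<Rightarrow> complex) \<Rightarrow> nat \<Rightarrow> complex.
    \<forall>x y a. f (\<lambda>i. x i + a * y i) = (\<lambda>i. f x i + a * f y i)}"
  morphisms app Seq_op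
  by (rule exI[of _ "\<lambda>x. x"]) simp

setup_lifting type_definition_seq_op

lemma app_lin: "app f (\<lambda>i. x i + a * y i) = (\<lambda>i. app f x i + a * app f y i)"
  using app[of f] by auto

lemma app_zero: "app f (\<lambda>i. 0) = (\<lambda>i. 0)"
  using app_lin[of f "\<lambda>i. 0" "-1" "\<lambda>i. 0"] by simp

lemma app_add: "app f (\<lambda>i. x i + y i) = (\<lambda>i. app f x i + app f y i)"
  using app_lin[of f x 1 y] by simp

lemma app_scale: "app f (\<lambda>i. a * y i) = (\<lambda>i. a * app f y i)"
  using app_lin[of f "\<lambda>i. 0" a y] by (simp add: app_zero)

lemma app_sum: "app f (\<lambda>i. \<Sum>k\<in>A. x k i) = (\<lambda>i. \<Sum>k\<in>A. app f (x k) i)"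
  by (induction A rule: infinite_finite_induct) (simp_all add: app_zero app_add)

lemma op_eqI: "(\<And>x. app f x = app g x) \<Longrightarrow> f = g"
  by (metis app_inject ext)

instantiation seq_op :: ring_1
begin

lift_definition zero_seq_op :: seq_op is "\<lambda>x i. 0" by simp
lift_definition one_seq_op :: seq_op is "\<lambda>x. x" by simp
lift_definition plus_seq_op :: "seq_op \<Rightarrow> seq_op \<Rightarrow> seq_op" is "\<lambda>f g x i. f x i + g x i"
  by (auto simp: algebra_simps)
lift_definition minus_seq_op :: "seq_op \<Rightarrow> seq_op \<Rightarrow> seq_op" is "\<lambda>f g x i. f x i - g x i"
  by (auto simp: algebra_simps)
lift_definition uminus_seq_op :: "seq_op \<Rightarrow> seq_op" is "\<lambda>f x i. - f x i"
  by (auto simp: algebra_simps)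
lift_definition times_seq_op :: "seq_op \<Rightarrow> seq_op \<Rightarrow> seq_op" is "\<lambda>f g x. f (g x)"
  by simp

instance
proof
  fix a b c :: seq_op
  show "a * (b + c) = a * b + a * c"
    by (rule op_eqI) (simp add: times_seq_op.rep_eq plus_seq_op.rep_eq app_add)
  have "app 0 (\<lambda>i. 1) \<noteq> app 1 (\<lambda>i. 1)"
    by (auto simp: zero_seq_op.rep_eq one_seq_op.rep_eq fun_eq_iff)
  then show "(0::seq_op) \<noteq> 1" by auto
qed (rule op_eqI, simp add: times_seq_op.rep_eq plus_seq_op.rep_eq minus_seq_op.rep_eq
      uminus_seq_op.rep_eq zero_seq_op.rep_eq one_seq_op.rep_eq app_add algebra_simps)+

end

lemmas app_simps = times_seq_op.rep_eq plus_seq_op.rep_eq minus_seq_op.rep_eq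
  uminus_seq_op.rep_eq zero_seq_op.rep_eq one_seq_op.rep_eq

lemma app_op_sum: "app (\<Sum>k\<in>A. f k) x = (\<lambda>i. \<Sum>k\<in>A. app (f k) x i)"
  by (induction A rule: infinite_finite_induct) (simp_all add: app_simps)

lift_definition scalar_op :: "complex \<Rightarrow> seq_op" is "\<lambda>a x i. a * x i"
  by (auto simp: algebra_simps)

lemma scalar_op_commute: "scalar_op a * f = f * scalar_op a"
  by (rule op_eqI) (simp add: app_simps scalar_op.rep_eq app_scale)

text \<open>
  Only the first \<open>q\<close> coordinates enter the inner product, so it is degenerate and an
  operator need not have a unique adjoint; hence adjointness is a relation between two
  operators.
\<close>

definition ip :: "nat \<Rightarrow> (nat \<Rightarrow> complex) \<Rightarrow> (nat \<Rightarrow> complex) \<Rightarrow> complex" where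
  "ip q x y = (\<Sum>i<q. x i * cnj (y i))"

definition adj_pair :: "nat \<Rightarrow> seq_op \<Rightarrow> seq_op \<Rightarrow> bool" where
  "adj_pair q f g \<longleftrightarrow> (\<forall>x y. ip q (app f x) y = ip q x (app g y))"

lemma ip_sum_left: "ip q (\<lambda>i. \<Sum>k\<in>A. x k i) y = (\<Sum>k\<in>A. ip q (x k) y)"
  unfolding ip_def sum_distrib_right by (rule sum.swap)

lemma ip_sum_right: "ip q x (\<lambda>i. \<Sum>k\<in>A. y k i) = (\<Sum>k\<in>A. ip q x (y k))"
  unfolding ip_def cnj_sum sum_distrib_left by (rule sum.swap)

lemma ip_lin_left: "ip q (\<lambda>i. x i + a * y i) z = ip q x z + a * ip q y z"
  unfolding ip_def by (simp add: sum.distrib sum_distrib_left algebra_simps)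

lemma ip_lin_right: "ip q z (\<lambda>i. x i + a * y i) = ip q z x + cnj a * ip q z y"
  unfolding ip_def by (simp add: sum.distrib sum_distrib_left algebra_simps)

lemma cnj_ip: "cnj (ip q x y) = ip q y x"
  unfolding ip_def by (simp add: mult.commute)

lemma adj_pair_mult: "adj_pair q f f' \<Longrightarrow> adj_pair q g g' \<Longrightarrow> adj_pair q (f * g) (g' * f')"
  unfolding adj_pair_def by (simp add: app_simps)

lemma adj_pair_add: "adj_pair q f f' \<Longrightarrow> adj_pair q g g' \<Longrightarrow> adj_pair q (f + g) (f' + g')"
  using ip_lin_left[where a = 1] ip_lin_right[where a = 1]
  unfolding adj_pair_def by (simp add: app_simps)

lemma adj_pair_uminus: "adj_pair q f f' \<Longrightarrow> adj_pair q (- f) (- f')"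
  unfolding adj_pair_def by (simp add: app_simps ip_def sum_negf)

lemma adj_pair_diff: "adj_pair q f f' \<Longrightarrow> adj_pair q g g' \<Longrightarrow> adj_pair q (f - g) (f' - g')"
  using adj_pair_add[of q f f' "- g" "- g'"] adj_pair_uminus[of q g g'] by simp

lemma adj_pair_zero: "adj_pair q 0 0"
  unfolding adj_pair_def by (simp add: app_simps ip_def)

lemma adj_pair_sum:
  "(\<And>k. k \<in> A \<Longrightarrow> adj_pair q (f k) (g k)) \<Longrightarrow> adj_pair q (\<Sum>k\<in>A. f k) (\<Sum>k\<in>A. g k)"
  by (induction A rule: infinite_finite_induct) (auto intro: adj_pair_zero adj_pair_add)

lemma adj_pair_scalar: "adj_pair q (scalar_op (complex_of_real a)) (scalar_op (complex_of_real a))"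
  unfolding adj_pair_def by (simp add: scalar_op.rep_eq ip_def sum_distrib_left mult.assoc mult.left_commute)

text \<open>
  Taking adjoints exchanges the right and the left recursion of the reciprocal.
\<close>

lemma adj_pair_recip:
  fixes g p :: seq_op
  assumes ug: "u 0 * g = p" "g * u 0 = p" and gp: "g * p = g" "p * g = g"
    and up: "\<And>j. u j * p = u j" "\<And>j. p * u j = u j"
    and u: "\<And>j. adj_pair q (u j) (u j)" and g: "adj_pair q g g"
  shows "adj_pair q (recip g u j) (recip g u j)"
proof (induction j rule: less_induct)
  case (less j)
  show ?case
  proof (cases j)
    case 0
    then show ?thesis using g by simp
  next
    case (Suc i)
    have "adj_pair q (g * (\<Sum>l\<le>i. u (Suc i - l) * recip g u l))
        ((\<Sum>l\<le>i. recip g u l * u (Suc i - l)) * g)"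
      by (intro adj_pair_mult adj_pair_sum g u less) (use Suc in auto)
    then have "adj_pair q (- (g * (\<Sum>l\<le>i. u (Suc i - l) * recip g u l)))
        (- ((\<Sum>l\<le>i. recip g u l * u (Suc i - l)) * g))"
      by (rule adj_pair_uminus)
    then show ?thesis
      unfolding Suc using recip_Suc_left[where g = g and u = u and p = p, OF ug gp up] by simp
  qed
qed

definition block_form :: "nat \<Rightarrow> nat \<Rightarrow> (nat \<Rightarrow> nat \<Rightarrow> seq_op) \<Rightarrow> (nat \<Rightarrow> nat \<Rightarrow> complex) \<Rightarrow> (nat \<Rightarrow> nat \<Rightarrow> complex) \<Rightarrow> complex" where
  "block_form q n h x y = (\<Sum>j\<le>n. \<Sum>k\<le>n. ip q (app (h j k) (x k)) (y j))"

definition block_psd :: "nat \<Rightarrow> nat \<Rightarrow> (nat \<Rightarrow> nat \<Rightarrow> seq_op) \<Rightarrow> bool" where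
  "block_psd q n h \<longleftrightarrow>
     (\<forall>j\<le>n. \<forall>k\<le>n. adj_pair q (h j k) (h k j)) \<and> (\<forall>x. 0 \<le> Re (block_form q n h x x))"

lemma block_form_cnj:
  assumes "block_psd q n h"
  shows "block_form q n h y x = cnj (block_form q n h x y)"
proof -
  have "cnj (block_form q n h x y) = (\<Sum>j\<le>n. \<Sum>k\<le>n. ip q (y j) (app (h j k) (x k)))"
    unfolding block_form_def by (simp add: cnj_ip)
  also have "\<dots> = (\<Sum>j\<le>n. \<Sum>k\<le>n. ip q (app (h k j) (y j)) (x k))"
    using assms unfolding block_psd_def adj_pair_def by (intro sum.cong) auto
  also have "\<dots> = block_form q n h y x"
    unfolding block_form_def by (rule sum.swap)
  finally show ?thesis by simp
qed

lemma block_form_lin_left: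
  "block_form q n h (\<lambda>k i. x k i + a * y k i) z = block_form q n h x z + a * block_form q n h y z"
  unfolding block_form_def by (simp add: app_lin ip_lin_left sum.distrib sum_distrib_left)

lemma block_form_lin_right:
  "block_form q n h z (\<lambda>k i. x k i + a * y k i) = block_form q n h z x + cnj a * block_form q n h z y"
  unfolding block_form_def by (simp add: ip_lin_right sum.distrib sum_distrib_left)

lemma nonneg_quadratic_linear_coeff_zero:
  fixes b c :: real
  assumes "\<And>t. 0 \<le> t * b + t\<^sup>2 * c"
  shows "b = 0"
proof (rule ccontr)
  assume b: "b \<noteq> 0"
  define d where "d = 1 + \<bar>c\<bar>"
  have d: "d > 0" "c < d" unfolding d_def by auto
  have "0 \<le> (- b / d) * b + (- b / d)\<^sup>2 * c" by (rule assms)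
  also have "\<dots> = b\<^sup>2 * (c - d) / d\<^sup>2"
    using d by (simp add: field_simps power2_eq_square)
  also have "\<dots> < 0"
    using b d by (simp add: divide_neg_pos mult_pos_neg)
  finally show False by simp
qed

text \<open>
  A vector on which a nonnegative Hermitian form vanishes lies in its radical: otherwise the
  form would become negative near \<open>x\<close> in the direction \<open>w = h x\<close>, since it depends on \<open>t\<close> as
  \<open>2 t \<parallel>w\<parallel>\<^sup>2 + O(t\<^sup>2)\<close> along \<open>x + t w\<close>.
\<close>

lemma block_psd_kernel:
  assumes psd: "block_psd q n h" and x: "block_form q n h x x = 0"
    and j: "j \<le> n" and i: "i < q"
  shows "(\<Sum>k\<le>n. app (h j k) (x k) i) = 0"
proof -
  define w where "w j i = (\<Sum>k\<le>n. app (h j k) (x k) i)" for j i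
  have w: "block_form q n h x y = (\<Sum>j\<le>n. ip q (w j) (y j))" for y
    unfolding block_form_def w_def ip_sum_left ..
  have "0 \<le> t * (2 * Re (block_form q n h x w)) + t\<^sup>2 * Re (block_form q n h w w)" for t :: real
  proof -
    let ?z = "\<lambda>k i. x k i + complex_of_real t * w k i"
    have "block_form q n h ?z ?z = complex_of_real t * (block_form q n h x w + block_form q n h w x)
        + complex_of_real (t\<^sup>2) * block_form q n h w w"
      unfolding block_form_lin_left block_form_lin_right x
      by (simp add: algebra_simps power2_eq_square)
    moreover have "0 \<le> Re (block_form q n h ?z ?z)" using psd unfolding block_psd_def by blast
    ultimately show ?thesis using block_form_cnj[OF psd, of w x] by simp
  qed
  then have "2 * Re (block_form q n h x w) = 0" by (rule nonneg_quadratic_linear_coeff_zero)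
  then have "(\<Sum>j\<le>n. \<Sum>i<q. (cmod (w j i))\<^sup>2) = 0"
    unfolding w ip_def by (simp add: complex_norm_square[symmetric] flip: of_real_power)
  then have "\<forall>j\<le>n. \<forall>i<q. w j i = 0"
    by (subst (asm) sum_nonneg_eq_0_iff) (auto intro: sum_nonneg simp: sum_nonneg_eq_0_iff)
  then show ?thesis using i j unfolding w_def by blast
qed

text \<open>
  The form of \<open>X h Y\<close> at \<open>v\<close> is the form of \<open>h\<close> at \<open>Y v\<close>, because \<open>X\<close> is the adjoint of \<open>Y\<close>.
\<close>

lemma block_psd_toeplitz_cong:
  assumes psd: "block_psd q n h" and xy: "\<And>j. adj_pair q (x j) (y j)" "\<And>j. adj_pair q (y j) (x j)"
  shows "block_psd q n (toeplitz_cong x h y)"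
  unfolding block_psd_def
proof (intro conjI allI impI)
  fix j k assume jk: "j \<le> n" "k \<le> n"
  have "adj_pair q (toeplitz_cong x h y j k) (\<Sum>l\<le>j. \<Sum>i\<le>k. x (k - i) * (h i l * y (j - l)))"
    unfolding toeplitz_cong_def
    by (intro adj_pair_sum adj_pair_mult xy) (use psd jk in \<open>auto simp: block_psd_def\<close>)
  also have "(\<Sum>l\<le>j. \<Sum>i\<le>k. x (k - i) * (h i l * y (j - l))) = toeplitz_cong x h y k j"
    unfolding toeplitz_cong_def mult.assoc by (rule sum.swap)
  finally show "adj_pair q (toeplitz_cong x h y j k) (toeplitz_cong x h y k j)" .
next
  fix v
  define v' where "v' l i = (\<Sum>j\<in>{l..n}. app (y (j - l)) (v j) i)" for l i
  have "block_form q n (toeplitz_cong x h y) v v =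
      (\<Sum>j\<le>n. \<Sum>k\<le>n. \<Sum>l\<le>j. \<Sum>i\<le>k. ip q (app (h l i) (app (y (k - i)) (v k))) (app (y (j - l)) (v j)))"
    unfolding block_form_def toeplitz_cong_def
    using xy(1) by (simp add: app_op_sum ip_sum_left app_simps adj_pair_def)
  also have "\<dots> = (\<Sum>j\<le>n. \<Sum>l\<le>j. \<Sum>k\<le>n. \<Sum>i\<le>k. ip q (app (h l i) (app (y (k - i)) (v k))) (app (y (j - l)) (v j)))"
    by (intro sum.cong refl sum.swap)
  also have "\<dots> = (\<Sum>l\<le>n. \<Sum>j\<in>{l..n}. \<Sum>i\<le>n. \<Sum>k\<in>{i..n}. ip q (app (h l i) (app (y (k - i)) (v k))) (app (y (j - l)) (v j)))"
    unfolding sum_le_triangle ..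
  also have "\<dots> = (\<Sum>l\<le>n. \<Sum>i\<le>n. \<Sum>j\<in>{l..n}. \<Sum>k\<in>{i..n}. ip q (app (h l i) (app (y (k - i)) (v k))) (app (y (j - l)) (v j)))"
    by (intro sum.cong refl sum.swap)
  also have "\<dots> = block_form q n h v' v'"
    unfolding block_form_def v'_def app_sum ip_sum_left ip_sum_right
    by (intro sum.cong refl sum.swap)
  finally show "0 \<le> Re (block_form q n (toeplitz_cong x h y) v v)"
    using psd unfolding block_psd_def by simp
qed

lemma block_psd_drop_first:
  assumes psd: "block_psd q (Suc n) h"
    and h': "\<And>j k. j \<le> n \<Longrightarrow> k \<le> n \<Longrightarrow> h (Suc j) (Suc k) = h' j k"
  shows "block_psd q n h'"
  unfolding block_psd_def
proof (intro conjI allI impI)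
  fix j k assume "j \<le> n" "k \<le> n"
  then show "adj_pair q (h' j k) (h' k j)"
    using psd h' unfolding block_psd_def by (metis Suc_le_mono)
next
  fix x
  let ?x = "\<lambda>k. case k of 0 \<Rightarrow> (\<lambda>i::nat. 0::complex) | Suc k \<Rightarrow> x k"
  have "block_form q (Suc n) h ?x ?x = block_form q n h' x x"
    unfolding block_form_def sum.atMost_Suc_shift
    by (simp add: app_zero ip_def h' cong: sum.cong_simp)
  then show "0 \<le> Re (block_form q n h' x x)"
    using psd unfolding block_psd_def by metis
qed

section \<open>Moore--Penrose inverses of Hermitian matrices\<close>

lemma mat_adjoint_dim [simp]: "dim_row (mat_adjoint A) = dim_col A" "dim_col (mat_adjoint A) = dim_row A"
  unfolding mat_adjoint_def by simp_all

lemma mat_adjoint_index [simp]: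
  "i < dim_col A \<Longrightarrow> j < dim_row A \<Longrightarrow> mat_adjoint A $$ (i, j) = cnj (A $$ (j, i))"
  unfolding mat_adjoint_def by (simp add: mat_of_rows_index)

lemma mat_adjoint_carrier [simp]: "A \<in> carrier_mat n m \<Longrightarrow> mat_adjoint A \<in> carrier_mat m n"
  by (intro carrier_matI) simp_all

lemma mat_adjoint_mult:
  fixes A B :: "complex mat"
  assumes "A \<in> carrier_mat n m" "B \<in> carrier_mat m k"
  shows "mat_adjoint (A * B) = mat_adjoint B * mat_adjoint A"
  by (rule eq_matI) (use assms in \<open>auto simp: scalar_prod_def mult.commute\<close>)

lemma cscalar_mat_adjoint:
  fixes A :: "complex mat"
  assumes A: "A \<in> carrier_mat n m" and v: "v \<in> carrier_vec m" and w: "w \<in> carrier_vec n"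
  shows "(A *\<^sub>v v) \<bullet>c w = v \<bullet>c (mat_adjoint A *\<^sub>v w)"
proof -
  have "(A *\<^sub>v v) \<bullet>c w = (\<Sum>i<n. \<Sum>j<m. A $$ (i, j) * v $ j * cnj (w $ i))"
    using assms by (simp add: scalar_prod_def sum_distrib_right atLeast0LessThan)
  also have "\<dots> = (\<Sum>j<m. \<Sum>i<n. A $$ (i, j) * v $ j * cnj (w $ i))"
    by (rule sum.swap)
  also have "\<dots> = v \<bullet>c (mat_adjoint A *\<^sub>v w)"
    using assms by (simp add: scalar_prod_def sum_distrib_left atLeast0LessThan mult_ac)
  finally show ?thesis .
qed

definition rank_one :: "nat \<Rightarrow> complex vec \<Rightarrow> complex \<Rightarrow> complex mat" where
  "rank_one n b c = mat n n (\<lambda>(i, j). b $ i * cnj (b $ j) / c)"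

lemma rank_one_mult_vec:
  assumes "b \<in> carrier_vec n" "v \<in> carrier_vec n"
  shows "rank_one n b c *\<^sub>v v = ((v \<bullet>c b) / c) \<cdot>\<^sub>v b"
  by (rule eq_vecI)
    (use assms in \<open>auto simp: rank_one_def scalar_prod_def sum_distrib_left sum_distrib_right sum_divide_distrib mult_ac intro!: sum.cong\<close>)

text \<open>
  One Gram--Schmidt step: \<open>P\<close> is an orthogonal projector, \<open>b\<close> the component of \<open>a\<close>
  orthogonal to its range, and \<open>P'\<close> projects onto the range of \<open>P\<close> together with \<open>a\<close>.
\<close>

lemma projector_extend:
  fixes P :: "complex mat"
  assumes P: "P \<in> carrier_mat n n" and PH: "mat_adjoint P = P"
    and PP: "\<And>v. v \<in> carrier_vec n \<Longrightarrow> P *\<^sub>v (P *\<^sub>v v) = P *\<^sub>v v"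
    and a: "a \<in> carrier_vec n" and b0: "a - P *\<^sub>v a \<noteq> 0\<^sub>v n"
  defines "b \<equiv> a - P *\<^sub>v a"
  defines "P' \<equiv> P + rank_one n b (b \<bullet>c b)"
  shows "P' \<in> carrier_mat n n" "mat_adjoint P' = P'"
    "\<And>v. v \<in> carrier_vec n \<Longrightarrow> P' *\<^sub>v (P' *\<^sub>v v) = P' *\<^sub>v v"
    "\<And>v. v \<in> carrier_vec n \<Longrightarrow> P *\<^sub>v v = v \<Longrightarrow> P' *\<^sub>v v = v"
    "P' *\<^sub>v a = a"
    "\<And>v. v \<in> carrier_vec n \<Longrightarrow> P' *\<^sub>v v = P *\<^sub>v v + ((v \<bullet>c b) / (b \<bullet>c b)) \<cdot>\<^sub>v b"
proof -
  have b: "b \<in> carrier_vec n" using a P unfolding b_def by auto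
  have Pv: "P *\<^sub>v v \<in> carrier_vec n" if "v \<in> carrier_vec n" for v using P that by auto
  have bb: "b \<bullet>c b \<noteq> 0" using b0 b unfolding b_def[symmetric] by simp
  have R: "rank_one n b (b \<bullet>c b) \<in> carrier_mat n n" by (simp add: rank_one_def)
  show P': "P' \<in> carrier_mat n n" using P R unfolding P'_def by auto
  show act: "P' *\<^sub>v v = P *\<^sub>v v + ((v \<bullet>c b) / (b \<bullet>c b)) \<cdot>\<^sub>v b" if "v \<in> carrier_vec n" for v
    using that P R b unfolding P'_def
    by (simp add: add_mult_distrib_mat_vec[OF P R] rank_one_mult_vec)
  have cc: "cnj (b \<bullet>c b) = b \<bullet>c b"
    by (simp add: scalar_prod_def mult.commute)
  show "mat_adjoint P' = P'"
  proof (rule eq_matI)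
    fix i j assume "i < dim_row P'" "j < dim_col P'"
    then have ij: "i < n" "j < n" using P' by auto
    have "cnj (P $$ (j, i)) = P $$ (i, j)"
      using mat_adjoint_index[of i P j] P PH ij by auto
    then show "mat_adjoint P' $$ (i, j) = P' $$ (i, j)"
      using ij P P' R b cc unfolding P'_def by (simp add: rank_one_def mult.commute)
  qed (use P' in auto)
  have Pb: "P *\<^sub>v b = 0\<^sub>v n"
  proof -
    have "P *\<^sub>v b = P *\<^sub>v a - P *\<^sub>v (P *\<^sub>v a)"
      unfolding b_def by (rule mult_minus_distrib_mat_vec[OF P a Pv[OF a]])
    also have "\<dots> = 0\<^sub>v n" using PP[OF a] Pv[OF a] by auto
    finally show ?thesis .
  qed
  have orth: "(P *\<^sub>v v) \<bullet>c b = 0" if "v \<in> carrier_vec n" for v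
    using cscalar_mat_adjoint[OF P that b] that by (simp add: PH Pb)
  show fixed: "P' *\<^sub>v v = v" if "v \<in> carrier_vec n" "P *\<^sub>v v = v" for v
    using act[OF that(1)] orth[OF that(1)] that b by auto
  have P'b: "P' *\<^sub>v b = b" using act[OF b] Pb bb b by auto
  have P'P: "P' *\<^sub>v (P *\<^sub>v v) = P *\<^sub>v v" if "v \<in> carrier_vec n" for v
    by (rule fixed) (use that Pv PP in auto)
  show "P' *\<^sub>v (P' *\<^sub>v v) = P' *\<^sub>v v" if v: "v \<in> carrier_vec n" for v
    using mult_add_distrib_mat_vec[OF P' Pv[OF v], of "((v \<bullet>c b) / (b \<bullet>c b)) \<cdot>\<^sub>v b"] v b P'
    by (simp add: act[OF v] P'P P'b mult_mat_vec)
  have "a = P *\<^sub>v a + b" unfolding b_def by (rule eq_vecI) (use a P in auto)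
  then have "P' *\<^sub>v a = P' *\<^sub>v (P *\<^sub>v a) + P' *\<^sub>v b"
    using mult_add_distrib_mat_vec[OF P' Pv[OF a] b] by metis
  also have "\<dots> = a" using P'P[OF a] P'b \<open>a = P *\<^sub>v a + b\<close> by simp
  finally show "P' *\<^sub>v a = a" .
qed

lemma mult_mat_unit_vec:
  assumes "A \<in> carrier_mat n m" "k < m"
  shows "A *\<^sub>v unit_vec m k = (col A k :: 'a::semiring_1 vec)"
  by (rule eq_vecI) (use assms in auto)

text \<open>
  The orthogonal projector onto the column space of \<open>A\<close>, obtained by feeding the columns one
  after the other to the Gram--Schmidt step. That it factors through \<open>A\<close> yields the
  generalized inverse below.
\<close>

lemma column_projector_exists:
  fixes A :: "complex mat"
  assumes A: "A \<in> carrier_mat n m"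
  obtains P X where "P \<in> carrier_mat n n" "X \<in> carrier_mat m n" "mat_adjoint P = P"
    "P = A * X" "P * A = A"
proof -
  have "\<exists>P X. P \<in> carrier_mat n n \<and> X \<in> carrier_mat m n \<and> mat_adjoint P = P \<and>
      P = A * X \<and> (\<forall>v\<in>carrier_vec n. P *\<^sub>v (P *\<^sub>v v) = P *\<^sub>v v) \<and>
      (\<forall>j<k. P *\<^sub>v col A j = col A j)" if "k \<le> m" for k
    using that
  proof (induction k)
    case 0
    have 0: "mat_adjoint (0\<^sub>m n n :: complex mat) = 0\<^sub>m n n" by (rule eq_matI) auto
    have 1: "0\<^sub>m n n *\<^sub>v v = (0\<^sub>v n :: complex vec)" if "v \<in> carrier_vec n" for v
      by (rule eq_vecI) (use that in auto)
    show ?case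
      by (rule exI[of _ "0\<^sub>m n n"], rule exI[of _ "0\<^sub>m m n"]) (use A 0 1 in auto)
  next
    case (Suc k)
    obtain P X where P: "P \<in> carrier_mat n n" and X: "X \<in> carrier_mat m n"
      and PH: "mat_adjoint P = P" and PX: "P = A * X"
      and PPb: "\<forall>v\<in>carrier_vec n. P *\<^sub>v (P *\<^sub>v v) = P *\<^sub>v v"
      and Pcb: "\<forall>j<k. P *\<^sub>v col A j = col A j"
      using Suc.IH[OF Suc_leD[OF Suc.prems]] by (elim exE conjE) (rule that)
    have PP: "P *\<^sub>v (P *\<^sub>v v) = P *\<^sub>v v" if "v \<in> carrier_vec n" for v
      using PPb that by blast
    have Pc: "P *\<^sub>v col A j = col A j" if "j < k" for j
      using Pcb that by blast
    define a where "a = col A k"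
    have a: "a \<in> carrier_vec n" using A unfolding a_def by auto
    show ?case
    proof (cases "a - P *\<^sub>v a = 0\<^sub>v n")
      case True
      have "P *\<^sub>v a = a"
      proof (rule eq_vecI)
        fix i assume i: "i < dim_vec a"
        have "(a - P *\<^sub>v a) $ i = 0" using True i a by simp
        then show "(P *\<^sub>v a) $ i = a $ i" using i a P by simp
      qed (use a P in auto)
      then have "\<forall>j<Suc k. P *\<^sub>v col A j = col A j"
        using Pc unfolding a_def by (metis less_Suc_eq)
      then show ?thesis
        by (intro exI[of _ P] exI[of _ X] conjI P X PH PX PPb)
    next
      case False
      define b where "b = a - P *\<^sub>v a"
      define P' where "P' = P + rank_one n b (b \<bullet>c b)"
      have b: "b \<in> carrier_vec n" using a P unfolding b_def by auto
      note ext = projector_extend[OF P PH PP a False, folded b_def, folded P'_def]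
      \<comment> \<open>\<open>b\<close> lies in the column space of \<open>A\<close>, with preimage \<open>d\<close>, and therefore so does
        every column of the rank-one correction.\<close>
      define d where "d = unit_vec m k - X *\<^sub>v a"
      have d: "d \<in> carrier_vec m" unfolding d_def
        by (intro minus_carrier_vec unit_vec_carrier mult_mat_vec_carrier[OF X a])
      have Ad: "A *\<^sub>v d = b"
        unfolding d_def b_def PX
      proof -
        have "k < m" using Suc.prems by simp
        then have "A *\<^sub>v unit_vec m k = a" unfolding a_def by (rule mult_mat_unit_vec[OF A])
        moreover have "A *\<^sub>v (unit_vec m k - X *\<^sub>v a) = A *\<^sub>v unit_vec m k - A *\<^sub>v (X *\<^sub>v a)"
          by (rule mult_minus_distrib_mat_vec[OF A]) (use X a in auto)
        ultimately show "A *\<^sub>v (unit_vec m k - X *\<^sub>v a) = a - A * X *\<^sub>v a"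
          using assoc_mult_mat_vec[OF A X a] by simp
      qed
      define Y where "Y = X + mat m n (\<lambda>(i, j). d $ i * cnj (b $ j) / (b \<bullet>c b))"
      have Y: "Y \<in> carrier_mat m n" using X unfolding Y_def by auto
      have bi: "b $ i = (\<Sum>l<m. A $$ (i, l) * d $ l)" if "i < n" for i
        using that A d unfolding Ad[symmetric] by (simp add: scalar_prod_def atLeast0LessThan)
      have "A * mat m n (\<lambda>(i, j). d $ i * cnj (b $ j) / (b \<bullet>c b)) = rank_one n b (b \<bullet>c b)"
      proof (rule eq_matI)
        fix i j assume "i < dim_row (rank_one n b (b \<bullet>c b))" "j < dim_col (rank_one n b (b \<bullet>c b))"
        then have ij: "i < n" "j < n" by (auto simp: rank_one_def)
        then show "(A * mat m n (\<lambda>(i, j). d $ i * cnj (b $ j) / (b \<bullet>c b))) $$ (i, j)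
            = rank_one n b (b \<bullet>c b) $$ (i, j)"
          using A by (simp add: rank_one_def scalar_prod_def bi sum_distrib_right sum_divide_distrib
              atLeast0LessThan mult.assoc)
      qed (use A in \<open>auto simp: rank_one_def\<close>)
      then have P'Y: "P' = A * Y"
        unfolding P'_def Y_def PX by (subst mult_add_distrib_mat[OF A X]) auto
      have cols: "\<forall>j<Suc k. P' *\<^sub>v col A j = col A j"
      proof (intro allI impI)
        fix j assume "j < Suc k"
        then consider "j < k" | "j = k" by linarith
        then show "P' *\<^sub>v col A j = col A j"
        proof cases
          case 1
          have "col A j \<in> carrier_vec n" using A by auto
          then show ?thesis using ext(4) Pc[OF 1] by blast
        next
          case 2
          then show ?thesis using ext(5) unfolding a_def by simp
        qed
      qed
      have idem: "\<forall>v\<in>carrier_vec n. P' *\<^sub>v (P' *\<^sub>v v) = P' *\<^sub>v v"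
        using ext(3) by blast
      show ?thesis
        by (intro exI[of _ P'] exI[of _ Y] conjI ext(1) Y ext(2) P'Y idem cols)
    qed
  qed
  from this[OF order_refl] obtain P X where P: "P \<in> carrier_mat n n" "X \<in> carrier_mat m n"
      "mat_adjoint P = P" "P = A * X" and c: "\<forall>j<m. P *\<^sub>v col A j = col A j"
    by (elim exE conjE) (rule that)
  have "P * A = A"
  proof (rule eq_matI)
    fix i j assume ij: "i < dim_row A" "j < dim_col A"
    then have "(P *\<^sub>v col A j) $ i = A $$ (i, j)" using c A by simp
    then show "(P * A) $$ (i, j) = A $$ (i, j)" using ij P(1) A by simp
  qed (use P(1) A in auto)
  then show ?thesis by (rule that[OF P])
qed

lemma moore_penrose_unique:
  assumes "is_moore_penrose A X" "is_moore_penrose A Y"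
  shows "X = Y"
proof -
  define n m where "n = dim_row A" and "m = dim_col A"
  have A: "A \<in> carrier_mat n m" and X: "X \<in> carrier_mat m n" and Y: "Y \<in> carrier_mat m n"
    using assms unfolding is_moore_penrose_def n_def m_def by auto
  have x: "A * X * A = A" "X * A * X = X" "mat_adjoint (A * X) = A * X" "mat_adjoint (X * A) = X * A"
    and y: "A * Y * A = A" "Y * A * Y = Y" "mat_adjoint (A * Y) = A * Y" "mat_adjoint (Y * A) = Y * A"
    using assms unfolding is_moore_penrose_def by auto
  have AX: "A * X \<in> carrier_mat n n" and AY: "A * Y \<in> carrier_mat n n"
    and XA: "X * A \<in> carrier_mat m m" and YA: "Y * A \<in> carrier_mat m m" using A X Y by auto
  have "A * X = A * Y * A * X" using y by simp
  also have "\<dots> = (A * Y) * (A * X)" by (rule assoc_mult_mat[OF AY A X])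
  also have "\<dots> = mat_adjoint ((A * X) * (A * Y))"
    using mat_adjoint_mult[OF AX AY] x y by simp
  also have "(A * X) * (A * Y) = A * Y"
    using assoc_mult_mat[OF AX A Y] x by simp
  finally have 1: "A * X = A * Y" using y by simp
  have "X * A = X * (A * Y * A)" using y by simp
  also have "\<dots> = (X * A) * (Y * A)"
    unfolding assoc_mult_mat[OF A Y A] by (rule assoc_mult_mat[OF X A YA, symmetric])
  also have "\<dots> = mat_adjoint ((Y * A) * (X * A))"
    using mat_adjoint_mult[OF YA XA] x y by simp
  also have "(Y * A) * (X * A) = Y * (A * X * A)"
    unfolding assoc_mult_mat[OF A X A] by (rule assoc_mult_mat[OF Y A XA])
  finally have 2: "X * A = Y * A" using y x by simp
  have "X = X * A * X" using x by simp
  also have "\<dots> = Y * (A * X)" unfolding 2 by (rule assoc_mult_mat[OF Y A X])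
  also have "\<dots> = Y" unfolding 1 using assoc_mult_mat[OF Y A Y] y by simp
  finally show ?thesis .
qed

text \<open>
  With the projector \<open>P = A X\<close> onto the range of a Hermitian \<open>A\<close>, the matrix \<open>Y = X\<^sup>* A X\<close>
  satisfies \<open>A Y = Y A = P\<close> and \<open>P Y = Y\<close>, which are the Moore--Penrose equations.
\<close>

lemma pinv_hermitian:
  assumes A: "A \<in> carrier_mat n n" and AH: "mat_adjoint A = A"
  shows "is_moore_penrose A (pinv A)" and "A * pinv A = pinv A * A" and "mat_adjoint (pinv A) = pinv A"
proof -
  obtain P X where P: "P \<in> carrier_mat n n" and X: "X \<in> carrier_mat n n"
    and PH: "mat_adjoint P = P" and AX: "P = A * X" and PA: "P * A = A"
    by (rule column_projector_exists[OF A])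
  let ?Xa = "mat_adjoint X"
  have Xa: "?Xa \<in> carrier_mat n n" using X by simp
  have XaA: "?Xa * A = P" using mat_adjoint_mult[OF A X] AH AX PH by simp
  have AP: "A * P = A" using mat_adjoint_mult[OF P A] AH PH PA by simp
  define Y where "Y = ?Xa * A * X"
  have Y: "Y \<in> carrier_mat n n" using A X unfolding Y_def by auto
  have YPX: "Y = P * X" unfolding Y_def XaA ..
  have AY: "A * Y = P" unfolding YPX using assoc_mult_mat[OF A P X] AP AX by simp
  have PXa: "Y = ?Xa * P" unfolding Y_def AX using assoc_mult_mat[OF Xa A X] by simp
  have YA: "Y * A = P" unfolding PXa using assoc_mult_mat[OF Xa P A] PA XaA by simp
  have PP: "P * P = P" using assoc_mult_mat[OF P A X] PA AX by simp
  have PY: "P * Y = Y" unfolding YPX using assoc_mult_mat[OF P P X] PP by simp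
  have mp: "is_moore_penrose A Y"
    unfolding is_moore_penrose_def using A Y AY YA PA PY PH by auto
  have eq: "pinv A = Y"
    unfolding pinv_def by (rule the_equality) (auto intro: mp moore_penrose_unique)
  show "is_moore_penrose A (pinv A)" "A * pinv A = pinv A * A" using mp AY YA unfolding eq by auto
  have "mat_adjoint Y = mat_adjoint X * P"
    unfolding YPX using mat_adjoint_mult[OF P X] PH by simp
  then show "mat_adjoint (pinv A) = pinv A" unfolding eq PXa .
qed

section \<open>Blocks of a matrix as operators\<close>

text \<open>
  The block in position \<open>(j, k)\<close> of a matrix partitioned into \<open>q \<times> q\<close> blocks, as an operator
  that ignores all coordinates from \<open>q\<close> on.
\<close>

lift_definition blk :: "nat \<Rightarrow> complex mat \<Rightarrow> nat \<Rightarrow> nat \<Rightarrow> seq_op" is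
  "\<lambda>q M j k x i. if i < q then \<Sum>b<q. M $$ (j * q + i, k * q + b) * x b else 0"
  by (auto simp: algebra_simps sum.distrib sum_distrib_left)

abbreviation mat_op :: "nat \<Rightarrow> complex mat \<Rightarrow> seq_op" where
  "mat_op q A \<equiv> blk q A 0 0"

lemma block_index_less: "j < a \<Longrightarrow> i < q \<Longrightarrow> j * q + i < a * (q::nat)"
proof -
  assume "j < a" "i < q"
  then have "j * q + i < Suc j * q" "Suc j * q \<le> a * q" by (simp_all only: mult_le_mono1 Suc_leI, simp)
  then show ?thesis by linarith
qed

lemma sum_blocks: "(\<Sum>c<n * q. f c) = (\<Sum>l<n. \<Sum>i<q. f (l * q + i))" for f :: "nat \<Rightarrow> 'a::comm_monoid_add"
proof -
  have "(\<Sum>i<q. f (l * q + i)) = sum f {l * q..<l * q + q}" for l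
    by (rule sum.reindex_bij_witness[of _ "\<lambda>c. c - l * q" "\<lambda>i. l * q + i"]) auto
  then show ?thesis by (simp add: sum.nat_group)
qed

lemma blk_mult:
  assumes M: "M \<in> carrier_mat (a * q) (n * q)" and N: "N \<in> carrier_mat (n * q) (b * q)"
    and jk: "j < a" "k < b"
  shows "blk q (M * N) j k = (\<Sum>l<n. blk q M j l * blk q N l k)"
proof (rule op_eqI, rule ext)
  fix x i
  show "app (blk q (M * N) j k) x i = app (\<Sum>l<n. blk q M j l * blk q N l k) x i"
  proof (cases "i < q")
    case True
    have "app (blk q (M * N) j k) x i =
        (\<Sum>c<q. (\<Sum>d<n * q. M $$ (j * q + i, d) * N $$ (d, k * q + c)) * x c)"
      using True M N block_index_less[OF jk(1) True] block_index_less[OF jk(2)]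
      by (simp add: blk.rep_eq scalar_prod_def atLeast0LessThan)
    also have "\<dots> = (\<Sum>c<q. \<Sum>l<n. \<Sum>e<q. M $$ (j * q + i, l * q + e) * N $$ (l * q + e, k * q + c) * x c)"
      by (simp add: sum_blocks sum_distrib_right)
    also have "\<dots> = (\<Sum>l<n. \<Sum>c<q. \<Sum>e<q. M $$ (j * q + i, l * q + e) * N $$ (l * q + e, k * q + c) * x c)"
      by (rule sum.swap)
    also have "\<dots> = (\<Sum>l<n. \<Sum>e<q. \<Sum>c<q. M $$ (j * q + i, l * q + e) * N $$ (l * q + e, k * q + c) * x c)"
      by (intro sum.cong refl sum.swap)
    also have "\<dots> = app (\<Sum>l<n. blk q M j l * blk q N l k) x i"
      using True by (simp add: app_op_sum app_simps blk.rep_eq sum_distrib_left mult.assoc)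
    finally show ?thesis .
  qed (simp add: app_op_sum app_simps blk.rep_eq)
qed

lemma mat_op_mult:
  "A \<in> carrier_mat q q \<Longrightarrow> B \<in> carrier_mat q q \<Longrightarrow> mat_op q (A * B) = mat_op q A * mat_op q B"
  using blk_mult[of A 1 q 1 B 1 0 0] by simp

lemma blk_add:
  "\<lbrakk>M \<in> carrier_mat (a * q) (b * q); N \<in> carrier_mat (a * q) (b * q); j < a; k < b\<rbrakk> \<Longrightarrow>
    blk q (M + N) j k = blk q M j k + blk q N j k"
  by (rule op_eqI, rule ext)
    (simp add: blk.rep_eq app_simps block_index_less sum.distrib distrib_right)

lemma blk_minus:
  "\<lbrakk>M \<in> carrier_mat (a * q) (b * q); N \<in> carrier_mat (a * q) (b * q); j < a; k < b\<rbrakk> \<Longrightarrow>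
    blk q (M - N) j k = blk q M j k - blk q N j k"
  by (rule op_eqI, rule ext)
    (simp add: blk.rep_eq app_simps block_index_less sum_subtractf left_diff_distrib)

lemmas mat_op_add = blk_add[of _ 1 q 1 _ 0 0 for q, simplified]
lemmas mat_op_minus = blk_minus[of _ 1 q 1 _ 0 0 for q, simplified]

lemma mat_op_uminus: "A \<in> carrier_mat q q \<Longrightarrow> mat_op q (- A) = - mat_op q A"
  by (rule op_eqI, rule ext) (simp add: blk.rep_eq app_simps sum_negf)

lemma mat_op_smult: "A \<in> carrier_mat q q \<Longrightarrow> mat_op q (c \<cdot>\<^sub>m A) = scalar_op c * mat_op q A"
  by (rule op_eqI, rule ext)
    (simp add: blk.rep_eq app_simps scalar_op.rep_eq sum_distrib_left mult.assoc)

lemma msum_carrier [simp]: "msum q f I \<in> carrier_mat q q"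
  unfolding msum_def by simp

lemma mat_op_msum: "mat_op q (msum q f I) = (\<Sum>l\<in>I. mat_op q (f l))"
proof (rule op_eqI, rule ext)
  fix x i
  show "app (mat_op q (msum q f I)) x i = app (\<Sum>l\<in>I. mat_op q (f l)) x i"
    by (simp add: blk.rep_eq app_op_sum msum_def sum_distrib_right sum.swap[of _ I])
qed

lemma blk_inject:
  assumes M: "M \<in> carrier_mat (a * q) (b * q)" and N: "N \<in> carrier_mat (a * q) (b * q)"
    and eq: "\<And>j k. j < a \<Longrightarrow> k < b \<Longrightarrow> blk q M j k = blk q N j k"
  shows "M = N"
proof (rule eq_matI)
  fix r c assume "r < dim_row N" "c < dim_col N"
  then have r: "r < a * q" and c: "c < b * q" using N by auto
  have q: "q > 0" using r by (cases q) auto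
  have jk: "r div q < a" "c div q < b" using r c by (simp_all add: less_mult_imp_div_less)
  have *: "app (blk q A (r div q) (c div q)) (\<lambda>i. if i = c mod q then 1 else 0) (r mod q) = A $$ (r, c)" for A
    using q by (simp add: blk.rep_eq if_distrib[of "\<lambda>x. _ * x"] cong: if_cong)
  show "M $$ (r, c) = N $$ (r, c)"
    using *[of M] *[of N] eq[OF jk] by simp
qed (use M N in auto)

lemma mat_op_inject:
  "\<lbrakk>A \<in> carrier_mat q q; B \<in> carrier_mat q q; mat_op q A = mat_op q B\<rbrakk> \<Longrightarrow> A = B"
  using blk_inject[of A 1 q 1 B] by simp

lemma adj_pair_mat_op_iff:
  assumes A: "A \<in> carrier_mat q q"
  shows "adj_pair q (mat_op q A) (mat_op q A) \<longleftrightarrow> mat_adjoint A = A"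
proof
  assume adj: "adj_pair q (mat_op q A) (mat_op q A)"
  show "mat_adjoint A = A"
  proof (rule eq_matI)
    fix i j assume "i < dim_row A" "j < dim_col A"
    then have ij: "i < q" "j < q" using A by auto
    let ?e = "\<lambda>k i. if i = (k::nat) then 1 else (0::complex)"
    have "ip q (app (mat_op q A) (?e i)) (?e j) = A $$ (j, i)"
      "ip q (?e i) (app (mat_op q A) (?e j)) = cnj (A $$ (i, j))"
      using ij by (simp_all add: ip_def blk.rep_eq if_distrib[of "\<lambda>x. _ * x"] if_distrib[of "\<lambda>x. x * _"]
          if_distrib[of cnj] cong: if_cong)
    then have "A $$ (j, i) = cnj (A $$ (i, j))" using adj unfolding adj_pair_def by metis
    then show "mat_adjoint A $$ (i, j) = A $$ (i, j)" using ij A by simp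
  qed (use A in auto)
next
  assume AH: "mat_adjoint A = A"
  have A': "cnj (A $$ (i, j)) = A $$ (j, i)" if "i < q" "j < q" for i j
    using mat_adjoint_index[of j A i] AH A that by simp
  show "adj_pair q (mat_op q A) (mat_op q A)"
    unfolding adj_pair_def
  proof (intro allI)
    fix x y
    have "ip q (app (mat_op q A) x) y = (\<Sum>i<q. \<Sum>j<q. A $$ (i, j) * x j * cnj (y i))"
      by (simp add: ip_def blk.rep_eq sum_distrib_right)
    also have "\<dots> = (\<Sum>j<q. \<Sum>i<q. A $$ (i, j) * x j * cnj (y i))"
      by (rule sum.swap)
    also have "\<dots> = ip q x (app (mat_op q A) y)"
      by (simp add: ip_def blk.rep_eq sum_distrib_left A' mult_ac)
    finally show "ip q (app (mat_op q A) x) y = ip q x (app (mat_op q A) y)" .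
  qed
qed

lemma block_hankel_carrier: "block_hankel q s n \<in> carrier_mat (Suc n * q) (Suc n * q)"
  by (simp add: block_hankel_def)

lemma block_row_carrier: "block_row q s n \<in> carrier_mat (1 * q) (n * q)"
  by (simp add: block_row_def)

lemma block_col_carrier: "block_col q s n \<in> carrier_mat (n * q) (1 * q)"
  by (simp add: block_col_def)

lemma blk_block_hankel:
  "j \<le> n \<Longrightarrow> k \<le> n \<Longrightarrow> blk q (block_hankel q s n) j k = mat_op q (s (j + k))"
  using block_index_less[of j "Suc n" _ q] block_index_less[of k "Suc n" _ q]
  by (intro op_eqI ext) (simp add: blk.rep_eq block_hankel_def)

lemma blk_block_row: "k < n \<Longrightarrow> blk q (block_row q s n) 0 k = mat_op q (s (n + k))"
  by (intro op_eqI ext) (simp add: blk.rep_eq block_row_def block_index_less)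

lemma blk_block_col: "j < n \<Longrightarrow> blk q (block_col q s n) j 0 = mat_op q (s (n + j))"
  by (intro op_eqI ext) (simp add: blk.rep_eq block_col_def block_index_less)

lemma hermitian_entries:
  assumes "\<And>j. j \<le> 2 * n \<Longrightarrow> s j \<in> carrier_mat q q"
    and "block_psd q n (hankel (\<lambda>j. mat_op q (s j)))" and "j \<le> 2 * n"
  shows "mat_adjoint (s j) = s j"
proof -
  have "j div 2 \<le> n" "j - j div 2 \<le> n" and eq: "j div 2 + (j - j div 2) = j"
    using assms(3) by auto
  then have "adj_pair q (hankel (\<lambda>j. mat_op q (s j)) (j div 2) (j - j div 2))
     (hankel (\<lambda>j. mat_op q (s j)) (j - j div 2) (j div 2))"
    using assms(2) unfolding block_psd_def by blast
  then show ?thesis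
    using adj_pair_mat_op_iff[OF assms(1)[OF assms(3)]] eq
    unfolding hankel_def by (simp add: add.commute)
qed

text \<open>
  The block form at \<open>x\<close> is the quadratic form of the block Hankel matrix at the vector whose
  blocks are the first \<open>q\<close> coordinates of the \<open>x\<^sub>j\<close>.
\<close>

lemma hankel_block_psd:
  assumes s: "\<And>j. j \<le> 2 * n \<Longrightarrow> s j \<in> carrier_mat q q"
    and nh: "nonneg_hermitian (block_hankel q s n)"
  shows "block_psd q n (hankel (\<lambda>j. mat_op q (s j)))"
  unfolding block_psd_def
proof (intro conjI allI impI)
  let ?H = "block_hankel q s n"
  fix j k assume jk: "j \<le> n" "k \<le> n"
  have "mat_adjoint (s (j + k)) = s (j + k)"
  proof (rule eq_matI)
    fix a b assume "a < dim_row (s (j + k))" "b < dim_col (s (j + k))"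
    then have ab: "a < q" "b < q" using s[of "j + k"] jk by auto
    have l: "j * q + a < Suc n * q" "k * q + b < Suc n * q" "j * q + b < Suc n * q" "k * q + a < Suc n * q"
      using ab jk by (intro block_index_less; simp)+
    have "mat_adjoint ?H $$ (k * q + a, j * q + b) = ?H $$ (k * q + a, j * q + b)"
      using nh unfolding nonneg_hermitian_def by simp
    then show "mat_adjoint (s (j + k)) $$ (a, b) = s (j + k) $$ (a, b)"
      using l ab s[of "j + k"] jk by (simp add: block_hankel_def add.commute)
  qed (use s[of "j + k"] jk in auto)
  then show "adj_pair q (hankel (\<lambda>j. mat_op q (s j)) j k) (hankel (\<lambda>j. mat_op q (s j)) k j)"
    using adj_pair_mat_op_iff[OF s[of "j + k"]] jk by (simp add: hankel_def add.commute)
next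
  let ?H = "block_hankel q s n"
  fix x :: "nat \<Rightarrow> nat \<Rightarrow> complex"
  define v where "v = vec (Suc n * q) (\<lambda>a. x (a div q) (a mod q))"
  have vi: "v $ (j * q + i) = x j i" if "j < Suc n" "i < q" for j i
    using block_index_less[OF that] that by (simp add: v_def)
  have "(?H *\<^sub>v v) \<bullet>c v = (\<Sum>r<Suc n * q. (\<Sum>c<Suc n * q. ?H $$ (r, c) * v $ c) * cnj (v $ r))"
    by (simp add: scalar_prod_def atLeast0LessThan v_def block_hankel_def)
  also have "\<dots> = (\<Sum>j<Suc n. \<Sum>i<q. (\<Sum>k<Suc n. \<Sum>b<q. ?H $$ (j * q + i, k * q + b) * x k b) * cnj (x j i))"
    unfolding sum_blocks by (intro sum.cong refl) (simp add: vi del: sum.lessThan_Suc)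
  also have "\<dots> = (\<Sum>j<Suc n. \<Sum>k<Suc n. ip q (app (blk q ?H j k) (x k)) (x j))"
    by (simp add: ip_def blk.rep_eq sum_distrib_right sum.swap[of _ "{..<q}" "{..<Suc n}"] del: sum.lessThan_Suc)
  also have "\<dots> = block_form q n (hankel (\<lambda>j. mat_op q (s j))) x x"
    unfolding block_form_def lessThan_Suc_atMost
    by (intro sum.cong refl) (simp add: blk_block_hankel hankel_def)
  finally have "(?H *\<^sub>v v) \<bullet>c v = block_form q n (hankel (\<lambda>j. mat_op q (s j))) x x" .
  moreover have "v \<in> carrier_vec (dim_row ?H)" by (simp add: v_def block_hankel_def)
  ultimately show "0 \<le> Re (block_form q n (hankel (\<lambda>j. mat_op q (s j))) x x)"
    using nh unfolding nonneg_hermitian_def by auto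
qed

section \<open>Schur complements of nonnegative block Hankel matrices\<close>

text \<open>
  Nonnegativity forces the range inclusion behind Schur complements: a vector annihilated by
  \<open>H\<^sub>n\<^sub>-\<^sub>1\<close> and extended by a zero block makes the form of \<open>H\<^sub>n\<close> vanish, so \<open>H\<^sub>n\<close>
  annihilates it too, in particular its last block row does.
\<close>

lemma block_row_kernel:
  assumes psd: "block_psd q n (hankel (\<lambda>j. mat_op q (s j)))" and n: "n = Suc n'"
    and N: "N \<in> carrier_mat (n * q) (b * q)" and GN: "block_hankel q s n' * N = 0\<^sub>m (n * q) (b * q)"
  shows "block_row q s n * N = 0\<^sub>m (1 * q) (b * q)"
proof (rule blk_inject)
  show "block_row q s n * N \<in> carrier_mat (1 * q) (b * q)"
    using block_row_carrier N by (rule mult_carrier_mat)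
  fix j k assume j: "j < (1::nat)" and k: "k < b"
  have G: "block_hankel q s n' \<in> carrier_mat (n * q) (n * q)"
    using block_hankel_carrier n by simp
  have one: "0 < (1::nat)" by simp
  have "app (blk q (block_row q s n * N) 0 k) x i = 0" for x i
  proof (cases "i < q")
    case i: True
    define y where "y l = (if l < n then app (blk q N l k) x else (\<lambda>i. 0))" for l
    have Sy: "(\<Sum>l\<le>n. app (mat_op q (s (j + l))) (y l) i) =
        app (\<Sum>l<n. mat_op q (s (j + l)) * blk q N l k) x i" for j i
      unfolding y_def lessThan_Suc_atMost[symmetric] app_op_sum
      by (simp add: app_zero app_simps)
    have "(\<Sum>l\<le>n. app (mat_op q (s (j + l))) (y l) i) = 0" if "j < n" for j i
    proof -
      have "(\<Sum>l<n. mat_op q (s (j + l)) * blk q N l k) = blk q (block_hankel q s n' * N) j k"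
        unfolding blk_mult[OF G N that k] using that n by (simp add: blk_block_hankel)
      also have "\<dots> = 0"
        unfolding GN by (rule op_eqI, rule ext)
          (use block_index_less[OF that] block_index_less[OF k] in \<open>simp add: blk.rep_eq app_simps\<close>)
      finally show ?thesis unfolding Sy by (simp add: app_simps)
    qed
    moreover have "y n = (\<lambda>i. 0)" by (simp add: y_def)
    ultimately have "ip q (\<lambda>i. \<Sum>l\<le>n. app (mat_op q (s (j + l))) (y l) i) (y j) = 0" if "j \<le> n" for j
      using that by (cases "j = n") (auto simp: ip_def)
    then have "block_form q n (hankel (\<lambda>j. mat_op q (s j))) y y = 0"
      unfolding block_form_def hankel_def ip_sum_left by simp
    from block_psd_kernel[OF psd this _ i, of n]
    have "(\<Sum>l\<le>n. app (mat_op q (s (n + l))) (y l) i) = 0" by (simp add: hankel_def)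
    then show ?thesis
      unfolding Sy blk_mult[OF block_row_carrier N one k]
      by (simp add: blk_block_row)
  qed (simp add: blk.rep_eq)
  then show "blk q (block_row q s n * N) j k = blk q (0\<^sub>m (1 * q) (b * q)) j k"
    using j by (intro op_eqI ext)
      (use block_index_less[OF k] in \<open>simp add: blk.rep_eq[of q "0\<^sub>m _ _"]\<close>)
qed simp

text \<open>
  The witness on the right is the column of blocks of \<open>- G\<^sup>\<dagger> c\<close> followed by \<open>1\<close>, where
  \<open>G = H\<^sub>n\<^sub>-\<^sub>1\<close> and \<open>c\<close> is the last block column of \<open>H\<^sub>n\<close> without its last block; it solves
  the system because \<open>G G\<^sup>\<dagger> c = c\<close>. This and its adjoint \<open>r G\<^sup>\<dagger> G = r\<close>, with the last block
  row \<open>r\<close>, follow from the range inclusion, as \<open>G\<close> annihilates \<open>1 - G\<^sup>\<dagger> G\<close>.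
\<close>

lemma hankel_schur_compl:
  assumes s: "\<And>j. j \<le> 2 * n \<Longrightarrow> s j \<in> carrier_mat q q"
    and psd: "block_psd q n (hankel (\<lambda>j. mat_op q (s j)))"
  shows "right_schur_compl (hankel (\<lambda>j. mat_op q (s j))) n (mat_op q (schur_compl q s n))"
    and "left_schur_compl (hankel (\<lambda>j. mat_op q (s j))) n (mat_op q (schur_compl q s n))"
    and "schur_compl q s n \<in> carrier_mat q q"
proof -
  let ?S = "\<lambda>j. mat_op q (s j)"
  have "right_schur_compl (hankel ?S) n (mat_op q (schur_compl q s n)) \<and>
    left_schur_compl (hankel ?S) n (mat_op q (schur_compl q s n)) \<and>
    schur_compl q s n \<in> carrier_mat q q"
  proof (cases n)
    case 0
    then show ?thesis using s[of 0]
      by (auto simp: right_schur_compl_def left_schur_compl_def hankel_def schur_compl_def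
          intro: exI[of _ "\<lambda>_. 1"])
  next
    case n: (Suc n')
    define G where "G = block_hankel q s n'"
    define X where "X = pinv G"
    define r where "r = block_row q s n"
    define c where "c = block_col q s n"
    have one: "0 < (1::nat)" by simp
    have G: "G \<in> carrier_mat (n * q) (n * q)" unfolding G_def n by (rule block_hankel_carrier)
    have r: "r \<in> carrier_mat (1 * q) (n * q)" unfolding r_def by (rule block_row_carrier)
    have c: "c \<in> carrier_mat (n * q) (1 * q)" unfolding c_def by (rule block_col_carrier)
    have herm: "mat_adjoint (s j) = s j" if "j \<le> 2 * n" for j
      by (rule hermitian_entries[OF _ psd that]) (rule s)
    have herm_entry: "cnj (s j $$ (a, b)) = s j $$ (b, a)" if "j \<le> 2 * n" "a < q" "b < q" for j a b
      using mat_adjoint_index[of b "s j" a] herm[OF that(1)] s[OF that(1)] that by simp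
    have GH: "mat_adjoint G = G"
    proof (rule eq_matI)
      fix i j assume "i < dim_row G" "j < dim_col G"
      then have ij: "i < n * q" "j < n * q" using G by auto
      then have "i div q < n" "j div q < n" "q > 0"
        by (simp_all add: less_mult_imp_div_less) (cases q, auto)
      then show "mat_adjoint G $$ (i, j) = G $$ (i, j)"
        using ij G unfolding G_def by (simp add: block_hankel_def n herm_entry add.commute)
    qed (use G in auto)
    have rH: "mat_adjoint r = c"
    proof (rule eq_matI)
      fix i j assume "i < dim_row c" "j < dim_col c"
      then have ij: "i < n * q" "j < q" using c by auto
      then have "i div q < n" "q > 0" by (simp_all add: less_mult_imp_div_less)
      then show "mat_adjoint r $$ (i, j) = c $$ (i, j)"
        using ij r unfolding r_def c_def by (simp add: block_row_def block_col_def herm_entry)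
    qed (use r c in auto)
    have mp: "G * X * G = G" "mat_adjoint (X * G) = X * G" and comm: "G * X = X * G"
      and Xd: "X \<in> carrier_mat (dim_col G) (dim_row G)"
      using pinv_hermitian(1,2)[OF G GH] unfolding X_def is_moore_penrose_def by auto
    have X: "X \<in> carrier_mat (n * q) (n * q)" using Xd G by simp
    have XG: "X * G \<in> carrier_mat (n * q) (n * q)" using X G by auto
    have "G * (1\<^sub>m (n * q) - X * G) = G - G * X * G"
      using G X by (simp add: mult_minus_distrib_mat[OF G one_carrier_mat XG])
    also have "\<dots> = 0\<^sub>m (n * q) (n * q)" unfolding mp using G by auto
    finally have "G * (1\<^sub>m (n * q) - X * G) = 0\<^sub>m (n * q) (n * q)" .
    then have "r * (1\<^sub>m (n * q) - X * G) = 0\<^sub>m (1 * q) (n * q)"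
      unfolding r_def G_def using XG G_def
      by (intro block_row_kernel[OF psd n] minus_carrier_mat) auto
    moreover have "r * (1\<^sub>m (n * q) - X * G) = r - r * (X * G)"
      using r by (simp add: mult_minus_distrib_mat[OF r one_carrier_mat XG])
    ultimately have "r - r * (X * G) = 0\<^sub>m (1 * q) (n * q)" by simp
    have rXG: "r * (X * G) = r"
    proof (rule eq_matI)
      fix i j assume ij: "i < dim_row r" "j < dim_col r"
      have "(r - r * (X * G)) $$ (i, j) = 0"
        using \<open>r - r * (X * G) = _\<close> ij r by simp
      moreover have "(r - r * (X * G)) $$ (i, j) = r $$ (i, j) - (r * (X * G)) $$ (i, j)"
        by (rule index_minus_mat(1)) (use ij r XG in auto)
      ultimately show "(r * (X * G)) $$ (i, j) = r $$ (i, j)" by simp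
    qed (use r XG in auto)
    have "c = (X * G) * c"
      using mat_adjoint_mult[OF r XG] unfolding rXG rH mp .
    then have GXc: "G * (X * c) = c"
      unfolding comm[symmetric] using assoc_mult_mat[OF G X c] by simp
    have Xc: "X * c \<in> carrier_mat (n * q) (1 * q)" and rX: "r * X \<in> carrier_mat (1 * q) (n * q)"
      using X c r by auto
    have L: "schur_compl q s n = s (2 * n) - r * X * c"
      unfolding schur_compl_def r_def X_def G_def c_def n by simp
    have rXc: "r * X * c \<in> carrier_mat (1 * q) (1 * q)" using rX c by (rule mult_carrier_mat)
    have s2: "s (2 * n) \<in> carrier_mat (1 * q) (1 * q)" using s by simp
    have bL: "mat_op q (schur_compl q s n) = ?S (2 * n) - mat_op q (r * X * c)"
      unfolding L by (rule blk_minus[OF s2 rXc]) auto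
    have bG: "blk q G j k = ?S (j + k)" if "j < n" "k < n" for j k
      using that unfolding G_def n by (simp add: blk_block_hankel)
    have br: "blk q r 0 k = ?S (n + k)" if "k < n" for k
      using that unfolding r_def by (rule blk_block_row)
    have bc: "blk q c j 0 = ?S (n + j)" if "j < n" for j
      using that unfolding c_def by (rule blk_block_col)
    define z where "z k = (if k = n then 1 else - blk q (X * c) k 0)" for k
    define w where "w k = (if k = n then 1 else - blk q (r * X) 0 k)" for k
    have zsum: "(\<Sum>k\<le>n. ?S (j + k) * z k) = ?S (j + n) - (\<Sum>k<n. ?S (j + k) * blk q (X * c) k 0)" for j
      unfolding lessThan_Suc_atMost[symmetric] z_def by (simp add: sum_negf)
    have wsum: "(\<Sum>j\<le>n. w j * ?S (j + k)) = ?S (n + k) - (\<Sum>j<n. blk q (r * X) 0 j * ?S (j + k))" for k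
      unfolding lessThan_Suc_atMost[symmetric] w_def by (simp add: sum_negf)
    have "(\<Sum>k\<le>n. ?S (j + k) * z k) = (if j = n then mat_op q (schur_compl q s n) else 0)" if "j \<le> n" for j
    proof (cases "j = n")
      case True
      have "mat_op q (r * X * c) = (\<Sum>k<n. ?S (n + k) * blk q (X * c) k 0)"
        unfolding assoc_mult_mat[OF r X c] using blk_mult[OF r Xc, of 0 0] by (simp add: br)
      then show ?thesis unfolding zsum bL True by (simp add: mult_2)
    next
      case False
      then have j: "j < n" using that by simp
      have "?S (n + j) = (\<Sum>k<n. ?S (j + k) * blk q (X * c) k 0)"
        using blk_mult[OF G Xc j, of 0] unfolding GXc by (simp add: bc[OF j] bG[OF j])
      then show ?thesis unfolding zsum using False by (simp add: add.commute)
    qed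
    then have R: "right_schur_compl (hankel ?S) n (mat_op q (schur_compl q s n))"
      unfolding right_schur_compl_def hankel_def by (intro exI[of _ z]) (simp add: z_def)
    have "(\<Sum>j\<le>n. w j * ?S (j + k)) = (if k = n then mat_op q (schur_compl q s n) else 0)" if "k \<le> n" for k
    proof (cases "k = n")
      case True
      have "mat_op q (r * X * c) = (\<Sum>j<n. blk q (r * X) 0 j * ?S (j + n))"
        using blk_mult[OF rX c, of 0 0] by (simp add: bc add.commute)
      then show ?thesis unfolding wsum bL True by (simp add: mult_2)
    next
      case False
      then have k: "k < n" using that by simp
      have "?S (n + k) = (\<Sum>j<n. blk q (r * X) 0 j * ?S (j + k))"
        using blk_mult[OF rX G one k] rXG unfolding assoc_mult_mat[OF r X G]
        by (simp add: br[OF k] bG[OF _ k])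
      then show ?thesis unfolding wsum using False by simp
    qed
    then have "left_schur_compl (hankel ?S) n (mat_op q (schur_compl q s n))"
      unfolding left_schur_compl_def hankel_def by (intro exI[of _ w]) (simp add: w_def)
    moreover have "schur_compl q s n \<in> carrier_mat q q"
      using minus_carrier_mat[OF rXc] unfolding L by simp
    ultimately show ?thesis using R by blast
  qed
  then show "right_schur_compl (hankel ?S) n (mat_op q (schur_compl q s n))"
    "left_schur_compl (hankel ?S) n (mat_op q (schur_compl q s n))"
    "schur_compl q s n \<in> carrier_mat q q" by auto
qed

section \<open>The Stieltjes class in terms of operators\<close>

lemma ip_zero: "ip q (\<lambda>i. 0) y = 0" "ip q x (\<lambda>i. 0) = 0"
  by (simp_all add: ip_def)

lemma block_psd_cong:
  assumes "block_psd q n h" "\<And>j k. j \<le> n \<Longrightarrow> k \<le> n \<Longrightarrow> h' j k = h j k"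
  shows "block_psd q n h'"
proof -
  have "block_form q n h' x y = block_form q n h x y" for x y
    unfolding block_form_def using assms(2) by (intro sum.cong) auto
  then show ?thesis using assms unfolding block_psd_def by simp
qed

lemma block_psd_mono:
  assumes "block_psd q n h" "n' \<le> n"
  shows "block_psd q n' h"
  unfolding block_psd_def
proof (intro conjI allI impI)
  fix j k assume "j \<le> n'" "k \<le> n'"
  then show "adj_pair q (h j k) (h k j)" using assms unfolding block_psd_def by auto
next
  fix x :: "nat \<Rightarrow> nat \<Rightarrow> complex"
  define y where "y k = (if k \<le> n' then x k else (\<lambda>i. 0))" for k
  have "block_form q n h y y = (\<Sum>j\<le>n. if j \<le> n' then \<Sum>k\<le>n. if k \<le> n' then ip q (app (h j k) (x k)) (x j) else 0 else 0)"
    unfolding block_form_def y_def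
    by (intro sum.cong refl) (auto simp: app_zero ip_zero intro!: sum.cong)
  also have "\<dots> = block_form q n' h x x"
  proof -
    have "{..n} \<inter> {j. j \<le> n'} = {..n'}" using assms(2) by auto
    then show ?thesis unfolding block_form_def by (simp add: sum.If_cases)
  qed
  finally show "0 \<le> Re (block_form q n' h x x)"
    using assms(1) unfolding block_psd_def by metis
qed

lemma right_schur_compl_cong:
  assumes "right_schur_compl h n L" "\<And>j k. j \<le> n \<Longrightarrow> k \<le> n \<Longrightarrow> h' j k = h j k"
  shows "right_schur_compl h' n L"
  using assms unfolding right_schur_compl_def by simp

lemma left_schur_compl_cong:
  assumes "left_schur_compl h n L" "\<And>j k. j \<le> n \<Longrightarrow> k \<le> n \<Longrightarrow> h' j k = h j k"
  shows "left_schur_compl h' n L"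
  using assms unfolding left_schur_compl_def by simp

text \<open>
  The last diagonal block enters the Schur complement additively.
\<close>

lemma right_schur_compl_corner:
  assumes R: "right_schur_compl h n L"
    and h': "\<And>j k. j \<le> n \<Longrightarrow> k \<le> n \<Longrightarrow> h' j k = h j k - (if j = n \<and> k = n then d else 0)"
  shows "right_schur_compl h' n (L - d)"
proof -
  obtain z where z: "z n = 1" "\<And>j. j \<le> n \<Longrightarrow> (\<Sum>k\<le>n. h j k * z k) = (if j = n then L else 0)"
    using R unfolding right_schur_compl_def by blast
  have "(\<Sum>k\<le>n. h' j k * z k) = (if j = n then L - d else 0)" if j: "j \<le> n" for j
  proof -
    have "(\<Sum>k\<le>n. h' j k * z k) = (\<Sum>k\<le>n. h j k * z k - (if k = n then if j = n then d else 0 else 0))"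
      by (intro sum.cong refl) (use j z(1) in \<open>auto simp: h' left_diff_distrib\<close>)
    also have "\<dots> = (if j = n then L else 0) - (if j = n then d else 0)"
      by (simp add: sum_subtractf z(2)[OF j])
    finally show ?thesis by simp
  qed
  then show ?thesis unfolding right_schur_compl_def using z(1) by blast
qed

lemma toeplitz_cong_scale:
  "toeplitz_cong (\<lambda>j. a * x j) h (\<lambda>j. y j * b) j k = a * toeplitz_cong x h y j k * b"
  unfolding toeplitz_cong_def by (simp add: sum_distrib_left sum_distrib_right mult.assoc)

text \<open>
  Even and odd \<open>m\<close> are treated at once: the two Hankel matrices involved are always the
  largest ones that can be formed from \<open>s\<^sub>0, \<dots>, s\<^sub>m\<close> and from the shifted sequence.
\<close>

definition stieltjes_psd :: "nat \<Rightarrow> nat \<Rightarrow> real \<Rightarrow> (nat \<Rightarrow> complex mat) \<Rightarrow> bool" where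
  "stieltjes_psd q m \<alpha> s \<longleftrightarrow>
     (\<forall>j\<le>m. s j \<in> carrier_mat q q) \<and>
     block_psd q (m div 2) (hankel (\<lambda>j. mat_op q (s j))) \<and>
     (1 \<le> m \<longrightarrow> block_psd q ((m - 1) div 2) (hankel (\<lambda>j. mat_op q (shift_seq \<alpha> s j))))"

lemma shift_seq_carrier:
  "s j \<in> carrier_mat q q \<Longrightarrow> s (Suc j) \<in> carrier_mat q q \<Longrightarrow> shift_seq \<alpha> s j \<in> carrier_mat q q"
  unfolding shift_seq_def by auto

lemma mat_op_shift_seq:
  assumes "s j \<in> carrier_mat q q" "s (Suc j) \<in> carrier_mat q q"
  shows "mat_op q (shift_seq \<alpha> s j) =
    - scalar_op (complex_of_real \<alpha>) * mat_op q (s j) + mat_op q (s (Suc j))"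
proof -
  have "scalar_op (- a) = - scalar_op a" for a
    by (rule op_eqI) (simp add: app_simps scalar_op.rep_eq)
  then show ?thesis
    using assms unfolding shift_seq_def by (simp add: mat_op_add mat_op_smult)
qed

lemma stieltjes_class_psd:
  assumes "s \<in> stieltjes_class q m \<alpha>"
  shows "stieltjes_psd q m \<alpha> s"
proof -
  have s: "s j \<in> carrier_mat q q" if "j \<le> m" for j
    using assms that unfolding stieltjes_class_def by auto
  have "nonneg_hermitian (block_hankel q s (m div 2))"
  proof (cases "m = 0")
    case True
    have "block_hankel q s 0 = s 0"
      by (rule eq_matI) (use s[of 0] in \<open>auto simp: block_hankel_def\<close>)
    then show ?thesis using assms True unfolding stieltjes_class_def by simp
  next
    case False
    then show ?thesis using assms unfolding stieltjes_class_def by (auto split: if_splits)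
  qed
  then have "block_psd q (m div 2) (hankel (\<lambda>j. mat_op q (s j)))"
    by (intro hankel_block_psd s) auto
  moreover have "block_psd q ((m - 1) div 2) (hankel (\<lambda>j. mat_op q (shift_seq \<alpha> s j)))" if m: "1 \<le> m"
  proof (rule hankel_block_psd)
    show "shift_seq \<alpha> s j \<in> carrier_mat q q" if "j \<le> 2 * ((m - 1) div 2)" for j
      by (intro shift_seq_carrier s) (use that m in auto)
    have "(m - 1) div 2 = (if even m then m div 2 - 1 else m div 2)"
      using m by (auto elim!: evenE oddE)
    then show "nonneg_hermitian (block_hankel q (shift_seq \<alpha> s) ((m - 1) div 2))"
      using assms m unfolding stieltjes_class_def by (auto split: if_splits)
  qed
  ultimately show ?thesis using s unfolding stieltjes_psd_def by auto
qed

text \<open>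
  The form of the Hankel matrix vanishes at the vector with \<open>x\<close> in block \<open>k\<close> and zeros
  elsewhere, because \<open>s\<^sub>2\<^sub>k x = 0\<close>; block row \<open>k + 1\<close> then says \<open>s\<^sub>2\<^sub>k\<^sub>+\<^sub>1 x = 0\<close>.
\<close>

lemma hankel_kernel_step:
  assumes psd: "block_psd q n (hankel (\<lambda>j. mat_op q (s j)))" and k: "Suc k \<le> n"
    and x: "app (mat_op q (s (2 * k))) x = (\<lambda>i. 0)"
  shows "app (mat_op q (s (Suc (2 * k)))) x = (\<lambda>i. 0)"
proof
  fix i
  define y where "y l = (if l = k then x else (\<lambda>i. 0))" for l
  have sum: "(\<Sum>l\<le>n. app (mat_op q (s (j + l))) (y l) i) = app (mat_op q (s (j + k))) x i" for j i
  proof -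
    have "(\<Sum>l\<le>n. app (mat_op q (s (j + l))) (y l) i) =
        (\<Sum>l\<le>n. if l = k then app (mat_op q (s (j + k))) x i else 0)"
      by (intro sum.cong refl) (simp add: y_def app_zero)
    then show ?thesis using k by simp
  qed
  have "block_form q n (hankel (\<lambda>j. mat_op q (s j))) y y =
      (\<Sum>j\<le>n. ip q (app (mat_op q (s (j + k))) x) (y j))"
    unfolding block_form_def hankel_def ip_sum_left[symmetric] sum ..
  also have "\<dots> = (\<Sum>j\<le>n. 0)"
    by (intro sum.cong refl) (use x in \<open>auto simp: y_def ip_def mult_2\<close>)
  finally have form: "block_form q n (hankel (\<lambda>j. mat_op q (s j))) y y = 0" by simp
  show "app (mat_op q (s (Suc (2 * k)))) x i = 0"
  proof (cases "i < q")
    case True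
    from block_psd_kernel[OF psd form k True] show ?thesis
      unfolding hankel_def sum by (simp add: mult_2)
  qed (simp add: blk.rep_eq)
qed

text \<open>
  The kernel of \<open>s\<^sub>0\<close> is contained in that of every \<open>s\<^sub>j\<close> with \<open>j < m\<close>. Odd indices are
  reached from the preceding even one by the Hankel matrix of \<open>s\<close>, even indices by that of
  the shifted sequence. The last index \<open>m\<close> is out of reach, which is the origin of the
  defect matrices.
\<close>

lemma stieltjes_kernel:
  assumes cls: "stieltjes_psd q m \<alpha> s"
    and x: "app (mat_op q (s 0)) x = (\<lambda>i. 0)" and "j < m"
  shows "app (mat_op q (s j)) x = (\<lambda>i. 0)"
  using \<open>j < m\<close>
proof (induction j rule: less_induct)
  case (less j)
  consider "j = 0" | k where "j = Suc (2 * k)" | k where "j = Suc (Suc (2 * k))"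
    by (metis evenE oddE Suc_eq_plus1 not0_implies_Suc even_Suc mult_Suc_right add_2_eq_Suc mult_0_right)
  then show ?case
  proof cases
    case 1
    then show ?thesis using x by simp
  next
    case 2
    have "block_psd q (m div 2) (hankel (\<lambda>j. mat_op q (s j)))"
      using cls unfolding stieltjes_psd_def by simp
    then show ?thesis
      unfolding 2 by (rule hankel_kernel_step) (use less 2 in auto)
  next
    case 3
    have psd: "block_psd q ((m - 1) div 2) (hankel (\<lambda>j. mat_op q (shift_seq \<alpha> s j)))"
      using cls less.prems unfolding stieltjes_psd_def by simp
    have c: "s i \<in> carrier_mat q q" if "i \<le> m" for i
      using cls that unfolding stieltjes_psd_def by simp
    have s0: "app (mat_op q (s (2 * k))) x = (\<lambda>i. 0)" "app (mat_op q (s (Suc (2 * k)))) x = (\<lambda>i. 0)"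
      using less 3 by auto
    have "app (mat_op q (shift_seq \<alpha> s (2 * k))) x = (\<lambda>i. 0)"
      using mat_op_shift_seq[where s = s and j = "2 * k" and \<alpha> = \<alpha>, OF c c] less.prems 3 s0
      by (simp add: app_simps app_zero)
    from hankel_kernel_step[OF psd _ this] have "app (mat_op q (shift_seq \<alpha> s (Suc (2 * k)))) x = (\<lambda>i. 0)"
      using less.prems 3 by simp
    then show ?thesis
      using mat_op_shift_seq[where s = s and j = "Suc (2 * k)" and \<alpha> = \<alpha>, OF c c] less.prems 3 s0
      by (simp add: app_simps app_zero)
  qed
qed

section \<open>The first Schur transform\<close>

lemma reciprocal_seq_carrier:
  assumes "pinv (u 0) \<in> carrier_mat q q"
  shows "reciprocal_seq q u j \<in> carrier_mat q q"
  using assms by (cases j) (auto intro!: uminus_carrier_mat mult_carrier_mat)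

lemma toeplitz_cong_cong:
  assumes "\<And>l i. l \<le> j \<Longrightarrow> i \<le> k \<Longrightarrow> x (j - l) * h l i * y (k - i) = x (j - l) * h' l i * y (k - i)"
  shows "toeplitz_cong x h y j k = toeplitz_cong x h' y j k"
  unfolding toeplitz_cong_def using assms by (intro sum.cong) auto

locale stieltjes_step =
  fixes q m :: nat and \<alpha> :: real and s :: "nat \<Rightarrow> complex mat"
  assumes psd: "stieltjes_psd q m \<alpha> s" and m: "1 \<le> m"
begin

text \<open>
  Here \<open>M\<close> is \<open>s\<close> written with operators, \<open>p\<close> the orthogonal projector onto the range of
  \<open>s\<^sub>0\<close>, and \<open>S\<close> the compression of \<open>M\<close> to it, continued by zero beyond \<open>m\<close>. As power series
  in \<open>z\<close>, \<open>U = (1 - \<alpha> z) S\<close> is the \<open>[+,\<alpha>]\<close>-transform of \<open>S\<close>, \<open>R = 1 / U\<close> its reciprocal,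
  \<open>V = (1 - \<alpha> z) R = 1 / S\<close>, and \<open>A\<close>, with \<open>U = S\<^sub>0 + z A\<close>, is the shifted sequence of \<open>S\<close>.
  The Schur transform of \<open>S\<close> is \<open>T\<close>, and \<open>B\<close> is the shifted sequence of \<open>T\<close>.
\<close>

definition M where "M j = mat_op q (s j)"
definition G where "G = mat_op q (pinv (s 0))"
definition p where "p = M 0 * G"
definition c where "c = scalar_op (complex_of_real \<alpha>)"
definition S where "S j = (if j \<le> m then p * M j * p else 0)"
definition A where "A j = - c * S j + S (Suc j)"
definition U where "U j = (case j of 0 \<Rightarrow> S 0 | Suc i \<Rightarrow> A i)"
definition R where "R = recip G U"
definition V where "V j = (case j of 0 \<Rightarrow> R 0 | Suc i \<Rightarrow> - c * R i + R (Suc i))"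
definition T where "T j = - (S 0 * R (Suc j) * S 0)"
definition B where "B j = - c * T j + T (Suc j)"
definition t where "t = schur_transform1 q \<alpha> s"

lemma s_carrier: "j \<le> m \<Longrightarrow> s j \<in> carrier_mat q q"
  using psd unfolding stieltjes_psd_def by auto

lemma psd_s: "block_psd q (m div 2) (hankel (\<lambda>j. mat_op q (s j)))"
  and psd_shift: "block_psd q ((m - 1) div 2) (hankel (\<lambda>j. mat_op q (shift_seq \<alpha> s j)))"
  using psd m unfolding stieltjes_psd_def by auto

lemma c_commute: "f * c = c * f" "f * (c * g) = c * (f * g)"
  unfolding c_def by (metis scalar_op_commute) (metis scalar_op_commute mult.assoc)

lemma adj_c: "adj_pair q c c"
  unfolding c_def by (rule adj_pair_scalar)

lemma mat_op_shift: "Suc j \<le> m \<Longrightarrow> mat_op q (shift_seq \<alpha> s j) = - c * M j + M (Suc j)"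
  unfolding c_def M_def by (intro mat_op_shift_seq s_carrier) auto

text \<open>
  The diagonal and off-diagonal blocks of \<open>H\<^sub>n\<close> cover the indices up to \<open>2 n\<close>; for odd \<open>m\<close>
  the last matrix \<open>s\<^sub>m\<close> is obtained from the last shifted one by adding \<open>\<alpha> s\<^sub>m\<^sub>-\<^sub>1\<close>.
\<close>

lemma adj_M:
  assumes "j \<le> m"
  shows "adj_pair q (M j) (M j)"
proof -
  have even: "adj_pair q (M j) (M j)" if "j \<le> 2 * (m div 2)" for j
    using hermitian_entries[OF _ psd_s that] s_carrier that adj_pair_mat_op_iff[of "s j" q]
    unfolding M_def by simp
  show ?thesis
  proof (cases "j \<le> 2 * (m div 2)")
    case False
    then have j: "j = m" "odd m" using assms by auto
    then obtain i where i: "m = Suc (2 * i)" by (auto elim!: oddE)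
    have "adj_pair q (mat_op q (shift_seq \<alpha> s (2 * i))) (mat_op q (shift_seq \<alpha> s (2 * i)))"
      using psd_shift unfolding i block_psd_def hankel_def by (auto simp: mult_2)
    then have "adj_pair q (- c * M (2 * i) + M m) (- c * M (2 * i) + M m)"
      using mat_op_shift[of "2 * i"] i by simp
    moreover have "adj_pair q (c * M (2 * i)) (c * M (2 * i))"
      using adj_pair_mult[OF adj_c even[of "2 * i"]] i by (simp add: c_commute)
    ultimately have "adj_pair q (- c * M (2 * i) + M m + c * M (2 * i)) (- c * M (2 * i) + M m + c * M (2 * i))"
      by (rule adj_pair_add)
    then show ?thesis using j by simp
  qed (rule even)
qed

lemma s0_herm: "mat_adjoint (s 0) = s 0"
  using adj_M[of 0] adj_pair_mat_op_iff[OF s_carrier[of 0]] unfolding M_def by simp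

lemma pinv_carrier: "pinv (s 0) \<in> carrier_mat q q"
  using pinv_hermitian(1)[OF s_carrier s0_herm] s_carrier[of 0] unfolding is_moore_penrose_def by simp

lemma GM: "G * M 0 = p" and MGM: "M 0 * G * M 0 = M 0" and GMG: "G * M 0 * G = G"
  using pinv_hermitian(1,2)[OF s_carrier s0_herm] s_carrier[of 0] pinv_carrier
  unfolding is_moore_penrose_def p_def M_def G_def
  by (simp_all flip: mat_op_mult)

lemma adj_G: "adj_pair q G G"
  using pinv_hermitian(3)[OF s_carrier s0_herm] adj_pair_mat_op_iff[OF pinv_carrier]
  unfolding G_def by simp

lemma adj_p: "adj_pair q p p"
  using adj_pair_mult[OF adj_M[of 0] adj_G] unfolding GM p_def[symmetric] by simp

lemma p_idem: "p * p = p" "p * (p * f) = p * f"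
proof -
  show "p * p = p" unfolding p_def using MGM by (simp add: mult.assoc[symmetric])
  then show "p * (p * f) = p * f" by (simp add: mult.assoc[symmetric])
qed

lemma pM0: "p * M 0 = M 0" "M 0 * p = M 0" and pG: "p * G = G" "G * p = G"
proof -
  show "p * M 0 = M 0" "G * p = G" using MGM GMG unfolding p_def by (simp_all add: mult.assoc)
  show "M 0 * p = M 0" "p * G = G"
    using MGM GMG unfolding GM[symmetric] by (simp_all add: mult.assoc)
qed

lemma M_p: "M j * p = M j" if "j < m"
proof (rule op_eqI)
  fix x
  have "app (mat_op q (s 0)) (app (1 - p) x) = app (M 0 * (1 - p)) x"
    by (simp add: app_simps M_def)
  also have "\<dots> = (\<lambda>i. 0)"
    by (simp add: right_diff_distrib pM0 app_simps)
  finally have "app (M j) (app (1 - p) x) = (\<lambda>i. 0)"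
    unfolding M_def by (rule stieltjes_kernel[OF psd _ that])
  moreover have "app (M j) (app (1 - p) x) = app (M j - M j * p) x"
    by (metis right_diff_distrib mult.right_neutral times_seq_op.rep_eq)
  ultimately have "app (M j - M j * p) x = (\<lambda>i. 0)" by simp
  then show "app (M j * p) x = app (M j) x"
    by (simp add: app_simps fun_eq_iff)
qed

lemma p_M: "p * M j = M j" if "j < m"
proof -
  let ?P = "s 0 * pinv (s 0)"
  have P: "?P \<in> carrier_mat q q" using s_carrier[of 0] pinv_carrier by auto
  have p: "p = mat_op q ?P" unfolding p_def M_def G_def using s_carrier[of 0] pinv_carrier by (simp add: mat_op_mult)
  have sj: "s j \<in> carrier_mat q q" using s_carrier that by simp
  have "s j * ?P = s j"
    using M_p[OF that] unfolding p M_def mat_op_mult[OF sj P, symmetric]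
    by (rule mat_op_inject[OF mult_carrier_mat[OF sj P] sj])
  moreover have "mat_adjoint ?P = ?P"
    using adj_p adj_pair_mat_op_iff[OF P] unfolding p by simp
  moreover have "mat_adjoint (s j) = s j"
    using adj_M[of j] that adj_pair_mat_op_iff[OF sj] unfolding M_def by simp
  ultimately have "?P * s j = s j" using mat_adjoint_mult[OF sj P] by simp
  then show ?thesis unfolding p M_def using mat_op_mult[OF P sj] by simp
qed

lemma S_eq_M: "j < m \<Longrightarrow> S j = M j"
  unfolding S_def by (simp add: p_M M_p mult.assoc)

lemma S0: "S 0 = M 0" using S_eq_M m by simp

lemma S_p: "S j * p = S j" "p * S j = S j"
  unfolding S_def by (simp_all add: p_idem mult.assoc)

lemma A_p: "A j * p = A j" "p * A j = A j"
  unfolding A_def by (simp_all add: algebra_simps S_p c_commute)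

lemma U_p: "U j * p = U j" "p * U j = U j"
  unfolding U_def by (auto split: nat.split simp: S_p A_p)

lemma U0: "U 0 * G = p" "G * U 0 = p"
  unfolding U_def by (simp_all add: S0 GM p_def)

lemma inverse_U: "conv_inverse p U R"
  unfolding R_def by (rule conv_inverse_recip) (simp_all add: U0 pG U_p)

lemma R0: "R 0 = G" by (simp add: R_def)

lemma S0G: "S 0 * G = p" by (simp add: S0 p_def)

lemma V0: "V 0 = G" by (simp add: V_def R0)

lemma R_p: "R j * p = R j" "p * R j = R j"
  using inverse_U unfolding conv_inverse_def by auto

text \<open>
  The central factor \<open>1 - \<alpha> z\<close> can be moved from \<open>S\<close> to \<open>R\<close> in \<open>S (1 - \<alpha> z) R = p\<close>; the
  facts \<open>move\<close> and \<open>move'\<close> do this on coefficients, with the factor on the right and on the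
  left series.
\<close>

lemma inverse_S: "conv_inverse p S V"
  unfolding conv_inverse_def
proof (intro conjI allI)
  fix j
  have UR: "(\<Sum>l\<le>j. U (j - l) * R l) = (if j = 0 then p else 0)"
    and RU: "(\<Sum>l\<le>j. R (j - l) * U l) = (if j = 0 then p else 0)"
    using inverse_U unfolding conv_inverse_def by auto
  have move: "(\<Sum>l\<le>j. x (j - l) * (case l of 0 \<Rightarrow> y 0 | Suc i \<Rightarrow> - c * y i + y (Suc i))) =
      (\<Sum>l\<le>j. x (j - l) * y l) - c * (\<Sum>l<j. x (j - Suc l) * y l)" for x y :: "nat \<Rightarrow> seq_op"
  proof (cases j)
    case (Suc i)
    have "(\<Sum>l\<le>i. x (i - l) * (- c * y l + y (Suc l))) =
      (\<Sum>l\<le>i. x (i - l) * y (Suc l)) - c * (\<Sum>l\<le>i. x (i - l) * y l)"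
      by (simp add: algebra_simps c_commute sum_subtractf sum_distrib_left)
    then show ?thesis
      unfolding Suc sum.atMost_Suc_shift lessThan_Suc_atMost by simp
  qed simp
  have move': "(\<Sum>l\<le>j. (case j - l of 0 \<Rightarrow> x 0 | Suc i \<Rightarrow> - c * x i + x (Suc i)) * y l) =
      (\<Sum>l\<le>j. x (j - l) * y l) - c * (\<Sum>l<j. x (j - Suc l) * y l)" for x y :: "nat \<Rightarrow> seq_op"
  proof -
    have "(case j - l of 0 \<Rightarrow> x 0 | Suc i \<Rightarrow> - c * x i + x (Suc i)) = x (j - l) - c * x (j - Suc l)"
      if "l < j" for l
      using that Suc_diff_Suc[OF that] by (auto split: nat.split)
    then have "(\<Sum>l<j. (case j - l of 0 \<Rightarrow> x 0 | Suc i \<Rightarrow> - c * x i + x (Suc i)) * y l) =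
        (\<Sum>l<j. x (j - l) * y l) - c * (\<Sum>l<j. x (j - Suc l) * y l)"
      by (simp add: left_diff_distrib sum_subtractf sum_distrib_left mult.assoc)
    then show ?thesis
      unfolding lessThan_Suc_atMost[symmetric] by simp
  qed
  have U': "U l = (case l of 0 \<Rightarrow> S 0 | Suc i \<Rightarrow> - c * S i + S (Suc i))" for l
    unfolding U_def A_def ..
  show "(\<Sum>l\<le>j. S (j - l) * V l) = (if j = 0 then p else 0)"
    unfolding V_def move UR[symmetric] unfolding U' move' ..
  show "(\<Sum>l\<le>j. V (j - l) * S l) = (if j = 0 then p else 0)"
    unfolding V_def move' RU[symmetric] unfolding U' move ..
  show "p * V j = V j" "V j * p = V j"
    unfolding V_def by (auto split: nat.split simp: R_p algebra_simps c_commute)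
qed

lemma V_p: "V j * p = V j" "p * V j = V j"
  using inverse_S unfolding conv_inverse_def by auto

lemma adj_S: "adj_pair q (S j) (S j)"
proof -
  have "adj_pair q (p * M j * p) (p * (M j * p))" if "j \<le> m"
    using adj_M[OF that] adj_p by (intro adj_pair_mult)
  then show ?thesis unfolding S_def by (simp add: mult.assoc adj_pair_zero)
qed

lemma adj_cR: "adj_pair q x x \<Longrightarrow> adj_pair q y y \<Longrightarrow> adj_pair q (y - c * x) (y - c * x)"
  using adj_pair_diff[of q y y "c * x" "x * c"] adj_pair_mult[OF adj_c, of x x] by (simp add: c_commute)

lemma adj_U: "adj_pair q (U j) (U j)"
  unfolding U_def A_def by (auto split: nat.split intro: adj_S adj_cR)

lemma adj_R: "adj_pair q (R j) (R j)"
  unfolding R_def by (rule adj_pair_recip[where p = p]) (simp_all add: U0 pG U_p adj_U adj_G)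

lemma adj_V: "adj_pair q (V j) (V j)"
  unfolding V_def by (auto split: nat.split intro: adj_R adj_cR)

text \<open>
  The two congruences on which everything rests: the Hankel array of \<open>T\<close> is congruent to
  that of \<open>A\<close>, and the direct sum of \<open>S\<^sub>0\<close> and the Hankel array of \<open>B\<close> is congruent to that
  of \<open>S\<close>.
\<close>

lemma hankel_T: "toeplitz_cong (\<lambda>j. S 0 * R j) (hankel A) (\<lambda>j. R j * S 0) j k = T (j + k)"
  using shifted_hankel_cong_inverse[OF inverse_U, of j k]
  unfolding toeplitz_cong_scale T_def by (simp add: U_def)

lemma hankel_B:
  "toeplitz_cong (\<lambda>j. S 0 * V j) (hankel S) (\<lambda>j. V j * S 0) (Suc j) (Suc k) = B (j + k)"
  "toeplitz_cong (\<lambda>j. S 0 * V j) (hankel S) (\<lambda>j. V j * S 0) (Suc j) 0 = 0"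
  unfolding toeplitz_cong_scale hankel_cong_inverse[OF inverse_S] B_def T_def
  by (simp_all add: V_def algebra_simps c_commute)

lemma T_schur_compl:
  assumes "right_schur_compl (hankel A) n L"
  shows "right_schur_compl (hankel T) n L"
proof -
  have "right_schur_compl (toeplitz_cong (\<lambda>j. S 0 * R j) (hankel A) (\<lambda>j. R j * S 0)) n L"
  proof (rule right_schur_compl_toeplitz_cong[OF assms, where p = p and y' = "\<lambda>j. G * U j"])
    show "(\<Sum>l\<le>j. R (j - l) * S 0 * (G * U l)) = (if j = 0 then p else 0)" for j
    proof -
      have "R (j - l) * S 0 * (G * U l) = R (j - l) * U l" for l
        by (metis S0 U_p(2) mult.assoc p_def)
      then show ?thesis using inverse_U unfolding conv_inverse_def by simp
    qed
  qed (simp_all add: hankel_def A_p R0 S_p mult.assoc U0 S0G)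
  then show ?thesis by (rule right_schur_compl_cong) (simp add: hankel_T hankel_def[of T])
qed

lemma B_schur_compl:
  assumes "right_schur_compl (hankel S) (Suc n) L"
  shows "right_schur_compl (hankel B) n L"
proof -
  have "right_schur_compl (toeplitz_cong (\<lambda>j. S 0 * V j) (hankel S) (\<lambda>j. V j * S 0)) (Suc n) L"
  proof (rule right_schur_compl_toeplitz_cong[OF assms, where p = p and y' = "\<lambda>j. G * S j"])
    show "(\<Sum>l\<le>j. V (j - l) * S 0 * (G * S l)) = (if j = 0 then p else 0)" for j
    proof -
      have "V (j - l) * S 0 * (G * S l) = V (j - l) * S l" for l
        by (metis S0 S_p(2) mult.assoc p_def)
      then show ?thesis using inverse_S unfolding conv_inverse_def by simp
    qed
  qed (simp_all add: hankel_def S_p V0 S0G mult.assoc, simp add: S0 GM)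
  then show ?thesis
    by (rule right_schur_compl_drop_first) (simp_all add: hankel_B hankel_def[of B])
qed

lemma t_carrier: "t j \<in> carrier_mat q q"
proof -
  have "reciprocal_seq q (plus_transform \<alpha> s) (j + 1) \<in> carrier_mat q q"
    by (rule reciprocal_seq_carrier) (simp add: plus_transform_def pinv_carrier)
  then show ?thesis
    unfolding t_def schur_transform1_def using s_carrier[of 0]
    by (intro uminus_carrier_mat mult_carrier_mat) auto
qed

lemma plus_transform_carrier: "j \<le> m \<Longrightarrow> plus_transform \<alpha> s j \<in> carrier_mat q q"
  unfolding plus_transform_def by (auto intro!: add_carrier_mat s_carrier)

text \<open>
  Since \<open>p\<close> commutes with scalars, compressing \<open>s\<close> before or after the \<open>[+,\<alpha>]\<close>-transform
  makes no difference.
\<close>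

lemma plus_transform_compress:
  assumes "j \<le> m"
  shows "p * mat_op q (plus_transform \<alpha> s j) * p = U j"
proof (cases j)
  case 0
  then show ?thesis by (simp add: plus_transform_def U_def M_def[symmetric] S0 pM0)
next
  case (Suc i)
  have "plus_transform \<alpha> s j = shift_seq \<alpha> s i"
    by (simp add: plus_transform_def shift_seq_def Suc)
  then show ?thesis
    using assms unfolding Suc
    by (simp add: mat_op_shift U_def A_def S_def algebra_simps c_commute)
qed

text \<open>
  Up to index \<open>m\<close> the reciprocal sequence only sees the compressions of the \<open>u\<^sub>j\<close>, because
  each of them stands between \<open>G = G p\<close> and \<open>R\<^sub>l = p R\<^sub>l\<close>.
\<close>

lemma mat_op_reciprocal: "j \<le> m \<Longrightarrow> mat_op q (reciprocal_seq q (plus_transform \<alpha> s) j) = R j"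
proof (induction j rule: less_induct)
  case (less j)
  let ?u = "plus_transform \<alpha> s" and ?r = "reciprocal_seq q (plus_transform \<alpha> s)"
  have u0: "pinv (?u 0) = pinv (s 0)" by (simp add: plus_transform_def)
  have rc: "?r l \<in> carrier_mat q q" for l
    by (rule reciprocal_seq_carrier) (simp add: u0 pinv_carrier)
  show ?case
  proof (cases j)
    case 0
    then show ?thesis by (simp add: u0 R0 G_def)
  next
    case (Suc i)
    have summand: "G * (mat_op q (?u (Suc i - l) * ?r l)) = G * (U (Suc i - l) * R l)" if l: "l \<le> i" for l
    proof -
      have "mat_op q (?u (Suc i - l) * ?r l) = mat_op q (?u (Suc i - l)) * R l"
        using less.IH[of l] less.prems l Suc mat_op_mult[OF plus_transform_carrier[of "Suc i - l"] rc[of l]]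
        by simp
      moreover have "G * (U (Suc i - l) * R l) = (G * p) * mat_op q (?u (Suc i - l)) * (p * R l)"
        using plus_transform_compress[of "Suc i - l"] less.prems Suc l
        by (simp add: mult.assoc flip: plus_transform_compress)
      ultimately show ?thesis by (simp add: pG R_p mult.assoc)
    qed
    have "mat_op q (?r j) = - (G * (\<Sum>l\<le>i. mat_op q (?u (Suc i - l) * ?r l)))"
      unfolding Suc reciprocal_seq.simps u0 G_def atLeast0AtMost
      using pinv_carrier by (subst mat_op_uminus) (auto simp: mat_op_mult mat_op_msum)
    also have "\<dots> = - (G * (\<Sum>l\<le>i. U (Suc i - l) * R l))"
      unfolding sum_distrib_left using summand by simp
    finally show ?thesis unfolding Suc R_def by simp
  qed
qed

lemma mat_op_t:
  assumes "j < m"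
  shows "mat_op q (t j) = T j"
proof -
  let ?r = "reciprocal_seq q (plus_transform \<alpha> s) (j + 1)"
  have r: "?r \<in> carrier_mat q q"
    by (rule reciprocal_seq_carrier) (simp add: plus_transform_def pinv_carrier)
  have s: "s 0 \<in> carrier_mat q q" by (simp add: s_carrier)
  have sr: "s 0 * ?r \<in> carrier_mat q q" using s r by (rule mult_carrier_mat)
  show ?thesis
    unfolding t_def schur_transform1_def mat_op_uminus[OF mult_carrier_mat[OF sr s]]
      mat_op_mult[OF sr s] mat_op_mult[OF s r]
    using mat_op_reciprocal[of "j + 1"] assms by (simp add: T_def S0 M_def)
qed

lemma mat_op_shift_t: "Suc j < m \<Longrightarrow> mat_op q (shift_seq \<alpha> t j) = B j"
  using mat_op_shift_seq[OF t_carrier t_carrier] mat_op_t unfolding B_def c_def by simp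

lemma mat_op_shift_A: "Suc j \<le> m \<Longrightarrow> p * mat_op q (shift_seq \<alpha> s j) * p = A j"
  by (simp add: mat_op_shift A_def S_def algebra_simps c_commute)

text \<open>
  The outer factors of the congruence absorb \<open>p\<close>, so the compressed sequence may be replaced
  by the original one, whose Hankel array is known to be nonnegative; \<open>psd_B\<close> proceeds in
  the same way.
\<close>

lemma psd_T: "block_psd q ((m - 1) div 2) (hankel (\<lambda>j. mat_op q (t j)))"
proof -
  let ?n = "(m - 1) div 2"
  let ?a = "hankel (\<lambda>j. mat_op q (shift_seq \<alpha> s j))"
  have adj: "adj_pair q (S 0 * R j) (R j * S 0)" "adj_pair q (R j * S 0) (S 0 * R j)" for j
    by (intro adj_pair_mult adj_S adj_R)+
  show ?thesis
  proof (rule block_psd_cong[OF block_psd_toeplitz_cong[OF psd_shift adj]])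
    fix j k assume jk: "j \<le> ?n" "k \<le> ?n"
    have "mat_op q (t (j + k)) = T (j + k)"
      by (rule mat_op_t) (use jk m in auto)
    also have "\<dots> = toeplitz_cong (\<lambda>j. S 0 * R j) (hankel A) (\<lambda>j. R j * S 0) j k"
      by (rule hankel_T[symmetric])
    also have "\<dots> = toeplitz_cong (\<lambda>j. S 0 * R j) ?a (\<lambda>j. R j * S 0) j k"
    proof (rule toeplitz_cong_cong)
      fix l i assume "l \<le> j" "i \<le> k"
      then have "A (l + i) = p * mat_op q (shift_seq \<alpha> s (l + i)) * p"
        using jk m by (intro mat_op_shift_A[symmetric]) auto
      then show "S 0 * R (j - l) * hankel A l i * (R (k - i) * S 0) =
          S 0 * R (j - l) * ?a l i * (R (k - i) * S 0)"
        unfolding hankel_def by (metis R_p mult.assoc)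
    qed
    finally show "hankel (\<lambda>j. mat_op q (t j)) j k = toeplitz_cong (\<lambda>j. S 0 * R j) ?a (\<lambda>j. R j * S 0) j k"
      by (simp add: hankel_def)
  qed
qed

lemma psd_B:
  assumes "2 \<le> m"
  shows "block_psd q ((m - 2) div 2) (hankel (\<lambda>j. mat_op q (shift_seq \<alpha> t j)))"
proof -
  let ?n = "(m - 2) div 2"
  let ?h = "hankel (\<lambda>j. mat_op q (s j))"
  have adj: "adj_pair q (S 0 * V j) (V j * S 0)" "adj_pair q (V j * S 0) (S 0 * V j)" for j
    by (intro adj_pair_mult adj_S adj_V)+
  have psd': "block_psd q (Suc ?n) ?h" using psd_s assms by (simp add: le_div_geq)
  show ?thesis
  proof (rule block_psd_drop_first[OF block_psd_toeplitz_cong[OF psd' adj]])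
    fix j k assume jk: "j \<le> ?n" "k \<le> ?n"
    have "toeplitz_cong (\<lambda>j. S 0 * V j) ?h (\<lambda>j. V j * S 0) (Suc j) (Suc k) =
        toeplitz_cong (\<lambda>j. S 0 * V j) (hankel S) (\<lambda>j. V j * S 0) (Suc j) (Suc k)"
    proof (rule toeplitz_cong_cong)
      fix l i assume "l \<le> Suc j" "i \<le> Suc k"
      then have "l + i \<le> m" using jk assms by auto
      then have "S (l + i) = p * mat_op q (s (l + i)) * p" by (simp add: S_def M_def)
      then show "S 0 * V (Suc j - l) * ?h l i * (V (Suc k - i) * S 0) =
          S 0 * V (Suc j - l) * hankel S l i * (V (Suc k - i) * S 0)"
        unfolding hankel_def by (metis V_p mult.assoc)
    qed
    also have "\<dots> = B (j + k)" by (rule hankel_B)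
    also have "\<dots> = mat_op q (shift_seq \<alpha> t (j + k))"
      by (rule mat_op_shift_t[symmetric]) (use jk assms in auto)
    finally show "toeplitz_cong (\<lambda>j. S 0 * V j) ?h (\<lambda>j. V j * S 0) (Suc j) (Suc k) =
        hankel (\<lambda>j. mat_op q (shift_seq \<alpha> t j)) j k"
      by (simp add: hankel_def)
  qed
qed

lemma stieltjes_psd_t: "stieltjes_psd q (m - 1) \<alpha> t"
  unfolding stieltjes_psd_def using t_carrier psd_T psd_B by (auto simp: numeral_2_eq_2)

text \<open>
  What the compression removes. It is zero below \<open>m\<close>, and at \<open>m\<close> it is the defect matrix
  \<open>E\<^sub>m\<^sub>,\<^sub>0\<close>.
\<close>

definition D where "D j = M j - S j"

lemma D_lt: "j < m \<Longrightarrow> D j = 0"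
  by (simp add: D_def S_eq_M)

lemma S_schur_compl:
  assumes "2 * n \<le> m"
  shows "right_schur_compl (hankel S) n (mat_op q (schur_compl q s n) - D (2 * n))"
proof (rule right_schur_compl_corner)
  show "right_schur_compl (hankel M) n (mat_op q (schur_compl q s n))"
    unfolding M_def
    by (rule hankel_schur_compl(1)[OF s_carrier block_psd_mono[OF psd_s]]) (use assms in auto)
  fix j k assume "j \<le> n" "k \<le> n"
  then show "hankel S j k = hankel M j k - (if j = n \<and> k = n then D (2 * n) else 0)"
    using assms S_eq_M[of "j + k"] by (auto simp: hankel_def D_def mult_2)
qed

lemma A_schur_compl:
  assumes "2 * n + 1 \<le> m"
  shows "right_schur_compl (hankel A) n (mat_op q (schur_compl q (shift_seq \<alpha> s) n) - D (2 * n + 1))"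
proof (rule right_schur_compl_corner)
  show "right_schur_compl (hankel (\<lambda>j. mat_op q (shift_seq \<alpha> s j))) n (mat_op q (schur_compl q (shift_seq \<alpha> s) n))"
  proof (rule hankel_schur_compl(1)[OF shift_seq_carrier block_psd_mono[OF psd_shift]])
    show "s j \<in> carrier_mat q q" "s (Suc j) \<in> carrier_mat q q" if "j \<le> 2 * n" for j
      using s_carrier that assms by auto
  qed (use assms in auto)
  fix j k assume jk: "j \<le> n" "k \<le> n"
  show "hankel A j k = hankel (\<lambda>j. mat_op q (shift_seq \<alpha> s j)) j k -
      (if j = n \<and> k = n then D (2 * n + 1) else 0)"
    using assms jk S_eq_M[of "j + k"] S_eq_M[of "Suc (j + k)"] mat_op_shift[of "j + k"]
    by (auto simp: hankel_def D_def A_def mult_2)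
qed

lemma stieltjes_param_carrier: "j \<le> m \<Longrightarrow> stieltjes_param q \<alpha> s j \<in> carrier_mat q q"
proof (cases "even j")
  case True
  assume "j \<le> m"
  then show ?thesis
    using True hankel_schur_compl(3)[OF s_carrier block_psd_mono[OF psd_s, of "j div 2"]]
    unfolding stieltjes_param_def by (auto simp: div_le_mono)
next
  case False
  assume "j \<le> m"
  then have j: "2 * (j div 2) + 1 \<le> m" using False by (auto elim!: oddE)
  have "schur_compl q (shift_seq \<alpha> s) (j div 2) \<in> carrier_mat q q"
  proof (rule hankel_schur_compl(3)[OF shift_seq_carrier block_psd_mono[OF psd_shift]])
    show "s i \<in> carrier_mat q q" "s (Suc i) \<in> carrier_mat q q" if "i \<le> 2 * (j div 2)" for i
      using s_carrier that j by auto
  qed (use j in auto)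
  then show ?thesis using False unfolding stieltjes_param_def by simp
qed

text \<open>
  Both sides are Schur complements of the same Hankel array: on the left by definition of
  the parameters of \<open>t\<close>, on the right through the congruences with the Hankel arrays of \<open>A\<close>
  and \<open>S\<close>. The left-sided and the right-sided description of a Schur complement agree, hence
  so do the two.
\<close>

lemma mat_op_stieltjes_param:
  assumes "j < m"
  shows "mat_op q (stieltjes_param q \<alpha> t j) = mat_op q (stieltjes_param q \<alpha> s (Suc j)) - D (Suc j)"
proof (cases "even j")
  case True
  then obtain n where n: "j = 2 * n" by (elim evenE)
  have "left_schur_compl (hankel (\<lambda>j. mat_op q (t j))) n (mat_op q (schur_compl q t n))"
    by (rule hankel_schur_compl(2)[OF t_carrier block_psd_mono[OF psd_T]]) (use n assms in auto)
  then have "left_schur_compl (hankel T) n (mat_op q (schur_compl q t n))"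
    by (rule left_schur_compl_cong) (use n assms in \<open>auto simp: hankel_def mat_op_t\<close>)
  moreover have "right_schur_compl (hankel T) n (mat_op q (schur_compl q (shift_seq \<alpha> s) n) - D (2 * n + 1))"
    by (intro T_schur_compl A_schur_compl) (use n assms in auto)
  ultimately show ?thesis
    using left_right_schur_compl_eq n by (fastforce simp: stieltjes_param_def)
next
  case False
  then obtain n where n: "j = Suc (2 * n)" by (auto elim: oddE)
  then have m2: "2 \<le> m" using assms by simp
  have "left_schur_compl (hankel (\<lambda>j. mat_op q (shift_seq \<alpha> t j))) n (mat_op q (schur_compl q (shift_seq \<alpha> t) n))"
    by (rule hankel_schur_compl(2)[OF shift_seq_carrier[OF t_carrier t_carrier] block_psd_mono[OF psd_B[OF m2]]])
      (use n assms in auto)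
  then have "left_schur_compl (hankel B) n (mat_op q (schur_compl q (shift_seq \<alpha> t) n))"
    by (rule left_schur_compl_cong) (use n assms in \<open>auto simp: hankel_def mat_op_shift_t\<close>)
  moreover have "right_schur_compl (hankel B) n (mat_op q (schur_compl q s (Suc n)) - D (2 * Suc n))"
    by (intro B_schur_compl S_schur_compl) (use n assms in auto)
  ultimately show ?thesis
    using left_right_schur_compl_eq n by (fastforce simp: stieltjes_param_def)
qed

lemma defect_carrier: "defect q \<alpha> s m 0 \<in> carrier_mat q q"
  and mat_op_defect: "mat_op q (defect q \<alpha> s m 0) = D m"
proof -
  let ?X = "pinv (s 0)"
  have s: "s 0 \<in> carrier_mat q q" "s m \<in> carrier_mat q q" by (simp_all add: s_carrier)
  note X = pinv_carrier
  note 1 = mult_carrier_mat[OF s(1) X]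
  note 2 = mult_carrier_mat[OF 1 s(2)]
  note 3 = mult_carrier_mat[OF 2 X]
  note 4 = mult_carrier_mat[OF 3 s(1)]
  have eq: "defect q \<alpha> s m 0 = s m - s 0 * ?X * s m * ?X * s 0"
    by (simp add: defect_def Let_def)
  show "defect q \<alpha> s m 0 \<in> carrier_mat q q" unfolding eq by (rule minus_carrier_mat[OF 4])
  show "mat_op q (defect q \<alpha> s m 0) = D m"
    unfolding eq mat_op_minus[OF s(2) 4] mat_op_mult[OF 3 s(1)] mat_op_mult[OF 2 X]
      mat_op_mult[OF 1 s(2)] mat_op_mult[OF s(1) X]
    using GM by (simp add: D_def S_def M_def G_def p_def mult.assoc)
qed

end

text \<open>
  One Schur transform shifts the parametrization by one, up to the defect in the last
  parameter.
\<close>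

lemma stieltjes_param_schur_transform1:
  assumes "stieltjes_psd q m \<alpha> s" "1 \<le> m"
  defines "t \<equiv> schur_transform1 q \<alpha> s"
  shows "stieltjes_psd q (m - 1) \<alpha> t"
    and "Suc j < m \<Longrightarrow> stieltjes_param q \<alpha> s (Suc j) = stieltjes_param q \<alpha> t j"
    and "stieltjes_param q \<alpha> s m = stieltjes_param q \<alpha> t (m - 1) + defect q \<alpha> s m 0"
proof -
  interpret stieltjes_step q m \<alpha> s by unfold_locales (use assms in auto)
  show psd_t: "stieltjes_psd q (m - 1) \<alpha> t"
    using stieltjes_psd_t unfolding local.t_def assms(3) .
  have tc: "stieltjes_param q \<alpha> t j \<in> carrier_mat q q" if "j < m" for j
  proof (cases "m = 1")
    case True
    then show ?thesis
      using that t_carrier[of 0] unfolding local.t_def assms(3)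
      by (simp add: stieltjes_param_def schur_compl_def)
  next
    case False
    then interpret t: stieltjes_step q "m - 1" \<alpha> t
      by unfold_locales (use psd_t assms(2) in auto)
    show ?thesis by (rule t.stieltjes_param_carrier) (use that in auto)
  qed
  have eq: "mat_op q (stieltjes_param q \<alpha> t j) = mat_op q (stieltjes_param q \<alpha> s (Suc j)) - D (Suc j)"
    if "j < m" for j
    using mat_op_stieltjes_param[OF that] unfolding local.t_def assms(3) .
  show "stieltjes_param q \<alpha> s (Suc j) = stieltjes_param q \<alpha> t j" if "Suc j < m"
    by (rule mat_op_inject[OF stieltjes_param_carrier tc]) (use that eq[of j] D_lt[of "Suc j"] in auto)
  show "stieltjes_param q \<alpha> s m = stieltjes_param q \<alpha> t (m - 1) + defect q \<alpha> s m 0"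
  proof (rule mat_op_inject)
    show "stieltjes_param q \<alpha> s m \<in> carrier_mat q q" by (simp add: stieltjes_param_carrier)
    show "stieltjes_param q \<alpha> t (m - 1) + defect q \<alpha> s m 0 \<in> carrier_mat q q"
      by (intro add_carrier_mat defect_carrier)
    show "mat_op q (stieltjes_param q \<alpha> s m) = mat_op q (stieltjes_param q \<alpha> t (m - 1) + defect q \<alpha> s m 0)"
      using eq[of "m - 1"] assms(2) mat_op_add[OF tc defect_carrier, of "m - 1"] mat_op_defect by simp
  qed
qed

section \<open>Iterating the transform\<close>

lemma schur_transform_Suc: "schur_transform q \<alpha> (Suc k) s = schur_transform q \<alpha> k (schur_transform1 q \<alpha> s)"
  by (induction k) simp_all

lemma defect_schur_transform1: "defect q \<alpha> (schur_transform1 q \<alpha> s) j k = defect q \<alpha> s j (Suc k)"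
  unfolding defect_def schur_transform_Suc ..

lemma defect_sum_Suc:
  assumes "defect q \<alpha> s (Suc m) 0 \<in> carrier_mat q q"
  shows "defect_sum q \<alpha> s (Suc m) (Suc m) =
    defect_sum q \<alpha> (schur_transform1 q \<alpha> s) m m + defect q \<alpha> s (Suc m) 0"
  by (rule eq_matI)
    (use assms in \<open>auto simp: defect_sum_def msum_def sum.atLeast0_lessThan_Suc_shift defect_schur_transform1
       simp del: sum.op_ivl_Suc\<close>)

lemma stieltjes_param_schur_transform:
  assumes "stieltjes_psd q m \<alpha> s"
  shows "stieltjes_param q \<alpha> s m = schur_transform q \<alpha> m s 0 + defect_sum q \<alpha> s m m \<and>
    schur_transform q \<alpha> m s 0 \<in> carrier_mat q q \<and>
    (\<forall>j<m. stieltjes_param q \<alpha> s j = schur_transform q \<alpha> j s 0)"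
  using assms
proof (induction m arbitrary: s)
  case 0
  then have s: "s 0 \<in> carrier_mat q q" unfolding stieltjes_psd_def by auto
  have "s 0 + defect_sum q \<alpha> s 0 0 = s 0"
    by (rule eq_matI) (use s in \<open>auto simp: defect_sum_def msum_def\<close>)
  then show ?case using s by (simp add: stieltjes_param_def schur_compl_def)
next
  case (Suc m)
  let ?t = "schur_transform1 q \<alpha> s"
  interpret stieltjes_step q "Suc m" \<alpha> s by unfold_locales (use Suc.prems in auto)
  note step = stieltjes_param_schur_transform1[OF Suc.prems, simplified]
  note IH = Suc.IH[OF step(1)]
  have sum: "defect_sum q \<alpha> ?t m m \<in> carrier_mat q q" by (simp add: defect_sum_def)
  have "stieltjes_param q \<alpha> s (Suc m) =
      schur_transform q \<alpha> m ?t 0 + defect_sum q \<alpha> ?t m m + defect q \<alpha> s (Suc m) 0"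
    using step(3) IH by simp
  also have "\<dots> = schur_transform q \<alpha> (Suc m) s 0 + defect_sum q \<alpha> s (Suc m) (Suc m)"
    unfolding schur_transform_Suc defect_sum_Suc[OF defect_carrier]
    using IH by (intro assoc_add_mat[OF _ sum defect_carrier]) simp
  finally have "stieltjes_param q \<alpha> s (Suc m) =
      schur_transform q \<alpha> (Suc m) s 0 + defect_sum q \<alpha> s (Suc m) (Suc m)" .
  moreover have "stieltjes_param q \<alpha> s j = schur_transform q \<alpha> j s 0" if "j < Suc m" for j
  proof (cases j)
    case 0
    then show ?thesis by (simp add: stieltjes_param_def schur_compl_def)
  next
    case (Suc i)
    then show ?thesis using step(2)[of i] IH that unfolding Suc schur_transform_Suc by simp
  qed
  ultimately show ?case using IH unfolding schur_transform_Suc by blast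
qed

theorem theorem9p12:
  fixes \<alpha> :: real and q m :: nat and s :: "nat \<Rightarrow> complex mat"
  assumes "q \<ge> 1"
    and "s \<in> stieltjes_class q m \<alpha>"
  shows "stieltjes_param q \<alpha> s m = schur_transform q \<alpha> m s 0 + defect_sum q \<alpha> s m m
    \<and> (m \<ge> 1 \<longrightarrow> (\<forall>j. j \<le> m - 1 \<longrightarrow> stieltjes_param q \<alpha> s j = schur_transform q \<alpha> j s 0))"
  using stieltjes_param_schur_transform[OF stieltjes_class_psd[OF assms(2)]] by auto

end
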